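(* Let $\gamma\in(0,1)$ and $z_0=(x_0,y_0)\in(0,\infty)^2$. For $\alpha\in(0,\pi/2)$, $$h^\alpha(z_0)=e^{x_0p(\alpha)+y_0q(\alpha)}\,\mathbb{P}^\alpha(T=\infty)=e^{x_0p(\alpha)+y_0q(\alpha)}-\mathbb{E}\left(e^{X_Tp(\alpha)+Y_Tq(\alpha)}\mathbf{1}_{T<\infty}\right),$$ and $$h^0(z_0)=y_0e^{x_0p(0)+y_0q(0)}-\mathbb{E}\left(Y_{T_1}e^{q(0)Y_{T_1}}\mathbf{1}_{T_1<T_2}\right),$$ $$h^{\pi/2}(z_0)=x_0e^{x_0p(\pi/2)+y_0q(\pi/2)}-\mathbb{E}\left(X_{T_2}e^{p(\pi/2)X_{T_2}}\mathbf{1}_{T_2<T_1}\right).$$ Moreover, when $x_0\to\infty$ and $y_0\to\infty$, $$h^\alpha(z_0)\sim e^{x_0p(\alpha)+y_0q(\alpha)}\ \ (\alpha\in(0,\pi/2)),\qquad h^0(z_0)\sim y_0e^{x_0p(0)+y_0q(0)},\qquad h^{\pi/2}(z_0)\sim x_0e^{x_0p(\pi/2)+y_0q(\pi/2)}.$$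
   Context: Let $W$ be a standard one-dimensional Brownian motion, and let $Z(t)=(X(t),Y(t))=z_0+\mathbf{W}(t)+\mu t$ with $\mathbf{W}(t)=(-W(t),W(t))$ and $\mu=(1-\gamma,\gamma)$. Let $T_1=\inf\{t\ge0: Z(t)\in\{0\}\times\mathbb{R}_+\}$, $T_2=\inf\{t\ge0: Z(t)\in\mathbb{R}_+\times\{0\}\}$, $T=T_1\wedge T_2$. For $\alpha\in(0,\pi/2)$, $(p(\alpha),q(\alpha))=\left(\frac{\gamma^2}{2}-\frac{1}{2(1+1/\tan\alpha)^2},\ \frac{(1-\gamma)^2}{2}-\frac{1}{2(1+\tan\alpha)^2}\right)$, extended by limits: $(p(0),q(0))=(\gamma^2/2,-\gamma+\gamma^2/2)$ and $(p(\pi/2),q(\pi/2))=((\gamma^2-1)/2,(1-\gamma)^2/2)$. These points lie on $K(p,q)=0$ where $K(p,q)=\frac12(p-q)^2+(1-\gamma)p+\gamma q$. $\mathbb{P}$ and $\mathbb{E}$ refer to the process started at $z_0$. $\mathbb{P}^\alpha$ is the probability obtained from $\mathbb{P}$ by Doob's $h$-transform with the harmonic function $(x,y)\mapsto e^{xp(\alpha)+yq(\alpha)}$: on the $\sigma$-field generated by $(W(s))_{s\le t}$ it has density $e^{(p(\alpha),q(\alpha))\cdot(\mathbf{W}(t)+\mu t)}$ with respect to $\mathbb{P}$; in particular $\mathbb{P}^\alpha(Z(t)\in S)=\mathbb{E}(e^{(p(\alpha),q(\alpha))\cdot(\mathbf{W}(t)+\mu t)}\mathbf{1}_{Z(t)\in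 S})$. Laplace transforms: $L_1(q)=\mathbb{E}(e^{qY(T_1)}\mathbf{1}_{T_1<T_2})$ for $\Re q<0$, $L_2(p)=\mathbb{E}(e^{pX(T_2)}\mathbf{1}_{T_2<T_1})$ for $\Re p<0$. With $P^-(q)=\gamma-1+q-\sqrt{(1-\gamma)^2-2q}$ and $Q^-(p)=-\gamma+p-\sqrt{\gamma^2-2p}$, they are continued analytically by $L_1(q)=e^{P^-(q)x_0+qy_0}-L_2(P^-(q))$ for $\Re q<(1-\gamma)^2/2$ and $L_2(p)=e^{px_0+Q^-(p)y_0}-L_1(Q^-(p))$ for $\Re p<\gamma^2/2$. The functions $h^\alpha$ are defined by $h^\alpha(z_0)=e^{p(\alpha)x_0+q(\alpha)y_0}-L_1(q(\alpha))-L_2(p(\alpha))$ for $\alpha\in(0,\pi/2)$, $h^{\pi/2}(z_0)=x_0e^{x_0p(\pi/2)+y_0q(\pi/2)}-L_2'(p(\pi/2))$ and $h^0(z_0)=y_0e^{x_0p(0)+y_0q(0)}-L_1'(q(0))$. *)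

theory Defs
  imports "HOL-Probability.Probability" "HOL-Complex_Analysis.Complex_Analysis"
begin

locale standard_brownian_motion = prob_space M
  for M :: "'a measure" and W :: "real \<Rightarrow> 'a \<Rightarrow> real" +
  assumes random_variable_W: "0 \<le> t \<Longrightarrow> random_variable borel (W t)"
    and start_at_zero: "\<omega> \<in> space M \<Longrightarrow> W 0 \<omega> = 0"
    and continuous_paths: "\<omega> \<in> space M \<Longrightarrow> continuous_on {0..} (\<lambda>t. W t \<omega>)"
    and normal_increments:
      "0 \<le> s \<Longrightarrow> s < t \<Longrightarrow>
        distributed M lborel (\<lambda>\<omega>. W t \<omega> - W s \<omega>) (normal_density 0 (sqrt (t - s)))"
    and independent_increments:
      "0 \<le> (\<tau> :: nat \<Rightarrow> real) 0 \<Longrightarrow> mono \<tau> \<Longrightarrow>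
        indep_vars (\<lambda>_. borel) (\<lambda>i \<omega>. W (\<tau> (Suc i)) \<omega> - W (\<tau> i) \<omega>) {..<n}"

definition driftW :: "(real \<Rightarrow> 'a \<Rightarrow> real) \<Rightarrow> real \<Rightarrow> real \<Rightarrow> 'a \<Rightarrow> real \<times> real" where
  "driftW W \<gamma> t \<omega> = (- W t \<omega>, W t \<omega>) + t *\<^sub>R (1 - \<gamma>, \<gamma>)"

definition Z :: "(real \<Rightarrow> 'a \<Rightarrow> real) \<Rightarrow> real \<Rightarrow> real \<times> real \<Rightarrow> real \<Rightarrow> 'a \<Rightarrow> real \<times> real" where
  "Z W \<gamma> z0 t \<omega> = z0 + driftW W \<gamma> t \<omega>"

definition T1 :: "(real \<Rightarrow> 'a \<Rightarrow> real) \<Rightarrow> real \<Rightarrow> real \<times> real \<Rightarrow> 'a \<Rightarrow> ereal" where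
  "T1 W \<gamma> z0 \<omega> = Inf {ereal t | t. 0 \<le> t \<and> Z W \<gamma> z0 t \<omega> \<in> {0} \<times> {0..}}"

definition T2 :: "(real \<Rightarrow> 'a \<Rightarrow> real) \<Rightarrow> real \<Rightarrow> real \<times> real \<Rightarrow> 'a \<Rightarrow> ereal" where
  "T2 W \<gamma> z0 \<omega> = Inf {ereal t | t. 0 \<le> t \<and> Z W \<gamma> z0 t \<omega> \<in> {0..} \<times> {0}}"

definition T :: "(real \<Rightarrow> 'a \<Rightarrow> real) \<Rightarrow> real \<Rightarrow> real \<times> real \<Rightarrow> 'a \<Rightarrow> ereal" where
  "T W \<gamma> z0 \<omega> = min (T1 W \<gamma> z0 \<omega>) (T2 W \<gamma> z0 \<omega>)"

text \<open>The coordinates of the process at a random time \<open>\<tau>\<close>; only meaningful where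
  \<open>\<tau> \<omega>\<close> is finite, so below they always occur under an indicator that ensures this.\<close>

definition X_at :: "(real \<Rightarrow> 'a \<Rightarrow> real) \<Rightarrow> real \<Rightarrow> real \<times> real \<Rightarrow> ('a \<Rightarrow> ereal) \<Rightarrow> 'a \<Rightarrow> real" where
  "X_at W \<gamma> z0 \<tau> \<omega> = fst (Z W \<gamma> z0 (real_of_ereal (\<tau> \<omega>)) \<omega>)"

definition Y_at :: "(real \<Rightarrow> 'a \<Rightarrow> real) \<Rightarrow> real \<Rightarrow> real \<times> real \<Rightarrow> ('a \<Rightarrow> ereal) \<Rightarrow> 'a \<Rightarrow> real" where
  "Y_at W \<gamma> z0 \<tau> \<omega> = snd (Z W \<gamma> z0 (real_of_ereal (\<tau> \<omega>)) \<omega>)"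

text \<open>The endpoints \<open>\<alpha> = 0\<close> and \<open>\<alpha> = pi/2\<close> are limits; the general formula does not yield them
  because \<open>1 / tan 0 = 0\<close> and \<open>tan (pi/2) = 0\<close> in HOL.\<close>

definition p :: "real \<Rightarrow> real \<Rightarrow> real" where
  "p \<gamma> \<alpha> =
    (if \<alpha> = 0 then \<gamma>\<^sup>2 / 2
     else if \<alpha> = pi/2 then (\<gamma>\<^sup>2 - 1) / 2
     else \<gamma>\<^sup>2 / 2 - 1 / (2 * (1 + 1 / tan \<alpha>)\<^sup>2))"

definition q :: "real \<Rightarrow> real \<Rightarrow> real" where
  "q \<gamma> \<alpha> =
    (if \<alpha> = 0 then - \<gamma> + \<gamma>\<^sup>2 / 2
     else if \<alpha> = pi/2 then (1 - \<gamma>)\<^sup>2 / 2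
     else (1 - \<gamma>)\<^sup>2 / 2 - 1 / (2 * (1 + tan \<alpha>)\<^sup>2))"

text \<open>The sigma-algebra on \<open>space M\<close> generated by the \<open>W s\<close> with \<open>s \<in> I\<close>.\<close>

definition path_algebra :: "'a measure \<Rightarrow> (real \<Rightarrow> 'a \<Rightarrow> real) \<Rightarrow> real set \<Rightarrow> 'a measure" where
  "path_algebra M W I = sigma (space M) {W s -` B \<inter> space M | s B. s \<in> I \<and> B \<in> sets borel}"

text \<open>\<open>N\<close> is the probability obtained from \<open>M\<close> by Doob's h-transform with the harmonic function
  \<open>(x, y) \<mapsto> exp (x * p \<gamma> \<alpha> + y * q \<gamma> \<alpha>)\<close>. It lives on the sigma-algebra generated by the whole
  path, where it is in general not absolutely continuous with respect to \<open>M\<close>; the densities on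
  finite time horizons determine it uniquely.\<close>

definition doob_transform ::
  "'a measure \<Rightarrow> (real \<Rightarrow> 'a \<Rightarrow> real) \<Rightarrow> real \<Rightarrow> real \<Rightarrow> 'a measure \<Rightarrow> bool" where
  "doob_transform M W \<gamma> \<alpha> N \<longleftrightarrow>
    prob_space N \<and> space N = space M \<and> sets N = sets (path_algebra M W {0..}) \<and>
    (\<forall>t\<ge>0. \<forall>A\<in>sets (path_algebra M W {0..t}).
      emeasure N A =
        (\<integral>\<^sup>+\<omega>. ennreal (exp ((p \<gamma> \<alpha>, q \<gamma> \<alpha>) \<bullet> driftW W \<gamma> t \<omega>)) * indicator A \<omega> \<partial>M))"

text \<open>The boundary Laplace transforms: the expectations define them for negative real part of the
  argument.\<close>

definition L1_transform ::
  "'a measure \<Rightarrow> (real \<Rightarrow> 'a \<Rightarrow> real) \<Rightarrow> real \<Rightarrow> real \<times> real \<Rightarrow> complex \<Rightarrow> complex" where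
  "L1_transform M W \<gamma> z0 w =
    (\<integral>\<omega>. exp (w * of_real (Y_at W \<gamma> z0 (T1 W \<gamma> z0) \<omega>))
          * indicator {\<omega>. T1 W \<gamma> z0 \<omega> < T2 W \<gamma> z0 \<omega>} \<omega> \<partial>M)"

definition L2_transform ::
  "'a measure \<Rightarrow> (real \<Rightarrow> 'a \<Rightarrow> real) \<Rightarrow> real \<Rightarrow> real \<times> real \<Rightarrow> complex \<Rightarrow> complex" where
  "L2_transform M W \<gamma> z0 w =
    (\<integral>\<omega>. exp (w * of_real (X_at W \<gamma> z0 (T2 W \<gamma> z0) \<omega>))
          * indicator {\<omega>. T2 W \<gamma> z0 \<omega> < T1 W \<gamma> z0 \<omega>} \<omega> \<partial>M)"

definition Pminus :: "real \<Rightarrow> complex \<Rightarrow> complex" where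
  "Pminus \<gamma> w = of_real \<gamma> - 1 + w - csqrt ((1 - of_real \<gamma>)\<^sup>2 - 2 * w)"

definition Qminus :: "real \<Rightarrow> complex \<Rightarrow> complex" where
  "Qminus \<gamma> w = - of_real \<gamma> + w - csqrt ((of_real \<gamma>)\<^sup>2 - 2 * w)"

text \<open>The continued transforms, to be used on \<open>Re w < (1 - \<gamma>)\<^sup>2 / 2\<close> for \<open>L1\<close> and on
  \<open>Re w < \<gamma>\<^sup>2 / 2\<close> for \<open>L2\<close> only. On these half-planes \<open>Pminus \<gamma> w\<close> and \<open>Qminus \<gamma> w\<close> have negative
  real part (for \<open>0 < \<gamma> < 1\<close>), so the other transform is there given by its expectation.\<close>

definition L1 ::
  "'a measure \<Rightarrow> (real \<Rightarrow> 'a \<Rightarrow> real) \<Rightarrow> real \<Rightarrow> real \<times> real \<Rightarrow> complex \<Rightarrow> complex" where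
  "L1 M W \<gamma> z0 w =
    (if Re w < 0 then L1_transform M W \<gamma> z0 w
     else exp (Pminus \<gamma> w * of_real (fst z0) + w * of_real (snd z0))
          - L2_transform M W \<gamma> z0 (Pminus \<gamma> w))"

definition L2 ::
  "'a measure \<Rightarrow> (real \<Rightarrow> 'a \<Rightarrow> real) \<Rightarrow> real \<Rightarrow> real \<times> real \<Rightarrow> complex \<Rightarrow> complex" where
  "L2 M W \<gamma> z0 w =
    (if Re w < 0 then L2_transform M W \<gamma> z0 w
     else exp (w * of_real (fst z0) + Qminus \<gamma> w * of_real (snd z0))
          - L1_transform M W \<gamma> z0 (Qminus \<gamma> w))"

definition h ::
  "'a measure \<Rightarrow> (real \<Rightarrow> 'a \<Rightarrow> real) \<Rightarrow> real \<Rightarrow> real \<Rightarrow> real \<times> real \<Rightarrow> complex" where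
  "h M W \<gamma> \<alpha> z0 =
    (if \<alpha> = 0 then
       of_real (snd z0 * exp (fst z0 * p \<gamma> 0 + snd z0 * q \<gamma> 0))
         - deriv (L1 M W \<gamma> z0) (of_real (q \<gamma> 0))
     else if \<alpha> = pi/2 then
       of_real (fst z0 * exp (fst z0 * p \<gamma> (pi/2) + snd z0 * q \<gamma> (pi/2)))
         - deriv (L2 M W \<gamma> z0) (of_real (p \<gamma> (pi/2)))
     else
       of_real (exp (p \<gamma> \<alpha> * fst z0 + q \<gamma> \<alpha> * snd z0))
         - L1 M W \<gamma> z0 (of_real (q \<gamma> \<alpha>)) - L2 M W \<gamma> z0 (of_real (p \<gamma> \<alpha>)))"

end

theory Submission
  imports Defs
begin

text \<open>The sum of the coordinates of the process is \<open>x0 + y0 + t\<close>, so the process never reaches the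
origin: \<open>T1\<close> is the first zero of the first coordinate, \<open>T2\<close> the first zero of the second one, and they differ
unless both are infinite. Whenever \<open>K(a, b) = 0\<close>, the function \<open>exp (a x + b y)\<close> is harmonic, which means that along the
process it is \<open>exp (a x0 + b y0)\<close> times the exponential martingale of \<open>W\<close> with parameter \<open>b - a\<close>.
All of the theorem comes from optional stopping of these martingales at the exit time.

For a finite horizon optional stopping is an identity (\<open>optional_stopping_bounded\<close>). As the horizon tends to
infinity it leaves an inequality (\<open>exit_exp_le\<close>): the expectation of \<open>exp (a X + b Y)\<close> at the exit, on the event that
the exit occurs, is at most its value at the start, and the defect is that value times the probability of survival
under the law tilted by the martingale. For the parameters \<open>(p(\<alpha>), q(\<alpha>))\<close> the
tilted law is the Doob transform, whence the probabilistic form of the defect (\<open>doob_survival\<close>).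

For given \<open>b\<close> the equation \<open>K(a, b) = 0\<close> has two roots. At the smaller root the tilted first coordinate has negative
drift, the process leaves the quadrant almost surely and the defect vanishes (\<open>exit_exp_eq_start\<close>). This is the
functional equation by which \<open>L1\<close> is continued, so the continued \<open>L1\<close> remains the expectation
\<open>E (exp (b Y(T1)); T1 < T2)\<close> for all real \<open>b < (1 - \<gamma>)\<^sup>2 / 2\<close> (\<open>L1_of_real\<close>). Since on each axis one coordinate vanishes,
\<open>L1 (q(\<alpha>)) + L2 (p(\<alpha>))\<close> is the expectation of the harmonic function at the exit, and \<open>h\<close> is the defect.
At the endpoints of the curve the derivative of the transform is taken under the expectation.

The asymptotics compare the two roots. The point \<open>(p(\<alpha>), q(\<alpha>))\<close> is the larger root in either variable, but
the exit through the vertical axis sees only \<open>b\<close>, so it may be bounded by the smaller root as well; this gains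
an exponential factor in \<open>x0\<close> (\<open>exit_exp_relative_bound\<close>). For \<open>\<alpha> = 0\<close> the additional factor \<open>Y\<close> is first absorbed by
\<open>Y \<le> y0 exp (Y / y0)\<close> (\<open>exit_left_moment_le\<close>). Exchanging the coordinates replaces \<open>W\<close> by \<open>- W\<close>, \<open>\<gamma>\<close> by
\<open>1 - \<gamma>\<close> and \<open>\<alpha>\<close> by \<open>pi / 2 - \<alpha>\<close>, which reduces statements about \<open>T2\<close> and about \<open>\<alpha> = pi / 2\<close> to those about \<open>T1\<close> and
\<open>\<alpha> = 0\<close>.\<close>

section \<open>Independence of increments from the past\<close>

context standard_brownian_motion
begin

lemma space_path_algebra [simp]: "space (path_algebra M W I) = space M"
  unfolding path_algebra_def by (rule space_measure_of) auto

lemma sets_path_algebra: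
  "sets (path_algebra M W I)
    = sigma_sets (space M) {W s -` B \<inter> space M | s B. s \<in> I \<and> B \<in> sets borel}"
  unfolding path_algebra_def by (rule sets_measure_of) auto

lemma path_algebra_mono:
  "I \<subseteq> J \<Longrightarrow> sets (path_algebra M W I) \<subseteq> sets (path_algebra M W J)"
  unfolding sets_path_algebra by (rule sigma_sets_mono') blast

lemma path_algebra_events:
  assumes "I \<subseteq> {0..}"
  shows "sets (path_algebra M W I) \<subseteq> events"
  unfolding sets_path_algebra
  by (intro sets.sigma_sets_subset subsetI)
    (use assms in \<open>auto intro!: measurable_sets[OF random_variable_W]\<close>)

lemma measurable_W_path_algebra:
  "s \<in> I \<Longrightarrow> W s \<in> borel_measurable (path_algebra M W I)"
  by (rule measurableI) (auto simp: sets_path_algebra intro!: sigma_sets.Basic)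

text \<open>Events that constrain \<open>W\<close> at finitely many times: a class stable under intersections that generates
  the past, and whose members can be expressed through finitely many increments.\<close>

definition cylinders :: "real set \<Rightarrow> 'a set set" where
  "cylinders I = {{\<omega> \<in> space M. \<forall>u\<in>J. W u \<omega> \<in> B u} | J B.
     finite J \<and> J \<subseteq> I \<and> (\<forall>u\<in>J. B u \<in> sets borel)}"

lemma Int_stable_cylinders: "Int_stable (cylinders I)"
proof (rule Int_stableI)
  fix a b assume "a \<in> cylinders I" "b \<in> cylinders I"
  then obtain J B J' B' where
    a: "a = {\<omega> \<in> space M. \<forall>u\<in>J. W u \<omega> \<in> B u}" "finite J" "J \<subseteq> I" "\<forall>u\<in>J. B u \<in> sets borel" and
    b: "b = {\<omega> \<in> space M. \<forall>u\<in>J'. W u \<omega> \<in> B' u}" "finite J'" "J' \<subseteq> I" "\<forall>u\<in>J'. B' u \<in> sets borel"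
    unfolding cylinders_def by blast
  define C where "C u = (if u \<in> J then B u else UNIV) \<inter> (if u \<in> J' then B' u else UNIV)" for u
  have "a \<inter> b = {\<omega> \<in> space M. \<forall>u\<in>J \<union> J'. W u \<omega> \<in> C u}"
    unfolding a b C_def by auto
  moreover have "\<forall>u\<in>J \<union> J'. C u \<in> sets borel"
    using a b by (auto simp: C_def)
  ultimately show "a \<inter> b \<in> cylinders I"
    unfolding cylinders_def using a(2,3) b(2,3)
    by (intro CollectI exI[of _ "J \<union> J'"] exI[of _ C]) simp
qed

lemma path_algebra_le_cylinders:
  "sets (path_algebra M W I) \<subseteq> sigma_sets (space M) (cylinders I)"
  unfolding sets_path_algebra
proof (rule sigma_sets_mono', clarify)
  fix s and B :: "real set" assume "s \<in> I" "B \<in> sets borel"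
  moreover have "W s -` B \<inter> space M = {\<omega> \<in> space M. \<forall>u\<in>{s}. W u \<omega> \<in> B}"
    by auto
  ultimately show "W s -` B \<inter> space M \<in> cylinders I"
    unfolding cylinders_def by (intro CollectI exI[of _ "{s}"] exI[of _ "\<lambda>_. B"]) auto
qed

lemma cylinder_in_events:
  assumes "A \<in> cylinders I" "I \<subseteq> {0..}"
  shows "A \<in> events"
proof -
  obtain J B where A: "A = {\<omega> \<in> space M. \<forall>u\<in>J. W u \<omega> \<in> B u}"
    "finite J" "J \<subseteq> I" "\<forall>u\<in>J. B u \<in> sets borel"
    using assms unfolding cylinders_def by blast
  have "{\<omega> \<in> space M. W u \<omega> \<in> B u} \<in> events" if "u \<in> J" for u
  proof -
    have "0 \<le> u" using that A assms by auto
    then have "W u -` B u \<inter> space M \<in> events"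
      using that A by (intro measurable_sets[OF random_variable_W]) auto
    then show ?thesis by (simp add: vimage_def Int_def conj_commute)
  qed
  then show ?thesis
    unfolding A(1) using A(2) by (intro sets.sets_Collect_finite_All) auto
qed

text \<open>Adding \<open>0\<close> and \<open>s\<close> to the constrained times and listing them in increasing order turns the cylinder
  into an event of the increments up to \<open>s\<close>, since \<open>W\<close> starts at zero; the increment from \<open>s\<close> to \<open>t\<close>
  is one more in the same list of independent increments.\<close>

lemma cylinder_increment_indep:
  assumes st: "0 \<le> s" "s < t" and A: "A \<in> cylinders {0..s}" and C: "C \<in> sets borel"
  shows "prob (A \<inter> ((\<lambda>\<omega>. W t \<omega> - W s \<omega>) -` C \<inter> space M))
    = prob A * prob ((\<lambda>\<omega>. W t \<omega> - W s \<omega>) -` C \<inter> space M)"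
proof -
  obtain J B where A_eq: "A = {\<omega> \<in> space M. \<forall>u\<in>J. W u \<omega> \<in> B u}"
    and J: "finite J" "J \<subseteq> {0..s}" and B: "\<forall>u\<in>J. B u \<in> sets borel"
    using A unfolding cylinders_def by blast
  define us where "us = sorted_list_of_set (insert 0 (insert s J))"
  define n where "n = length us - 1"
  define \<tau> where "\<tau> i = (if i \<le> n then us ! i else t)" for i
  have set_us: "set us = insert 0 (insert s J)" and sorted: "sorted us"
    using J by (simp_all add: us_def del: sorted_list_of_set_insert_remove)
  then have len: "length us = Suc n"
    unfolding n_def by (metis insert_not_empty length_0_conv list.set(1) Suc_pred gr0I diff_Suc_1)
  have us_range: "us ! i \<in> {0..s}" if "i \<le> n" for i
  proof -
    have "us ! i \<in> set us" using that len by simp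
    then show ?thesis using set_us J st by auto
  qed
  have ex_idx: "\<exists>i\<le>n. us ! i = u" if "u \<in> insert 0 (insert s J)" for u
    using that unfolding set_us[symmetric] in_set_conv_nth len by (auto simp: less_Suc_eq_le)
  have us_mono: "us ! i \<le> us ! j" if "i \<le> j" "j \<le> n" for i j
    using sorted_nth_mono[OF sorted that(1)] that(2) len by simp
  have "\<tau> 0 = 0"
    using ex_idx[of 0] us_mono us_range[of 0] by (force simp: \<tau>_def)
  have "\<tau> n = s"
    using ex_idx[of s] us_mono[of _ n] us_range[of n] by (force simp: \<tau>_def)
  have "mono \<tau>"
  proof (rule monoI)
    fix i j :: nat assume "i \<le> j"
    then show "\<tau> i \<le> \<tau> j"
      using us_mono[of i j] us_range[of i] st by (auto simp: \<tau>_def)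
  qed
  define D where "D i \<omega> = W (\<tau> (Suc i)) \<omega> - W (\<tau> i) \<omega>" for i \<omega>
  have ind: "indep_vars (\<lambda>_. borel) D {..<Suc n}"
    unfolding D_def using \<open>\<tau> 0 = 0\<close> \<open>mono \<tau>\<close> by (intro independent_increments) auto
  have Dn: "D n \<omega> = W t \<omega> - W s \<omega>" for \<omega>
    unfolding D_def \<open>\<tau> n = s\<close> by (simp add: \<tau>_def)
  \<comment> \<open>The sequence \<open>\<tau>\<close> enumerates the times and stays at \<open>t\<close> afterwards, so increment number \<open>n\<close> is the one
    from \<open>s\<close> to \<open>t\<close> and the earlier ones recover \<open>W\<close> at all listed times.\<close>
  have W_sum: "W (us ! i) \<omega> = (\<Sum>j<i. D j \<omega>)" if "i \<le> n" "\<omega> \<in> space M" for i \<omega>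
  proof -
    have "(\<Sum>j<i. D j \<omega>) = W (\<tau> i) \<omega> - W (\<tau> 0) \<omega>"
      unfolding D_def by (rule sum_lessThan_telescope)
    then show ?thesis
      using that start_at_zero \<open>\<tau> 0 = 0\<close> by (simp add: \<tau>_def)
  qed
  obtain k where k: "\<And>u. u \<in> J \<Longrightarrow> k u \<le> n \<and> us ! (k u) = u"
    using ex_idx by (metis insertCI)
  let ?P = "PiM {..<n} (\<lambda>_. borel) :: (nat \<Rightarrow> real) measure"
  let ?Q = "PiM {n} (\<lambda>_. borel) :: (nat \<Rightarrow> real) measure"
  define SA where "SA = {x \<in> space ?P. \<forall>u\<in>J. (\<Sum>j<k u. x j) \<in> B u}"
  define SC where "SC = {x \<in> space ?Q. x n \<in> C}"
  have iv: "indep_var ?P (\<lambda>\<omega>. restrict (\<lambda>i. D i \<omega>) {..<n}) ?Q (\<lambda>\<omega>. restrict (\<lambda>i. D i \<omega>) {n})"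
    by (rule indep_var_restrict[OF ind]) auto
  have meas: "(\<lambda>x. \<Sum>j<k u. x j) \<in> borel_measurable ?P" if "u \<in> J" for u
    using k[OF that] by (intro borel_measurable_sum measurable_component_singleton) auto
  have "SA \<in> sets ?P"
    unfolding SA_def using J
  proof (intro sets.sets_Collect_finite_All)
    fix u assume u: "u \<in> J"
    show "{x \<in> space ?P. (\<Sum>j<k u. x j) \<in> B u} \<in> sets ?P"
      using measurable_sets[OF meas[OF u], of "B u"] B u
      by (simp add: vimage_def Int_def conj_commute)
  qed auto
  moreover have "SC \<in> sets ?Q"
    using measurable_sets[OF measurable_component_singleton, of n "{n}" C "\<lambda>_. borel"] C
    by (simp add: SC_def vimage_def Int_def conj_commute)
  ultimately have "prob ((\<lambda>\<omega>. restrict (\<lambda>i. D i \<omega>) {..<n}) -` SA \<inter> space M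
      \<inter> ((\<lambda>\<omega>. restrict (\<lambda>i. D i \<omega>) {n}) -` SC \<inter> space M))
    = prob ((\<lambda>\<omega>. restrict (\<lambda>i. D i \<omega>) {..<n}) -` SA \<inter> space M)
      * prob ((\<lambda>\<omega>. restrict (\<lambda>i. D i \<omega>) {n}) -` SC \<inter> space M)"
    using iv unfolding indep_var_eq by (intro indep_setD) (auto intro!: sigma_sets.Basic)
  moreover have "(\<lambda>\<omega>. restrict (\<lambda>i. D i \<omega>) {..<n}) -` SA \<inter> space M = A"
  proof -
    have "(\<Sum>j<k u. restrict (\<lambda>i. D i \<omega>) {..<n} j) = W u \<omega>" if "u \<in> J" "\<omega> \<in> space M" for u \<omega>
    proof -
      have "(\<Sum>j<k u. restrict (\<lambda>i. D i \<omega>) {..<n} j) = (\<Sum>j<k u. D j \<omega>)"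
        using k[OF that(1)] by (intro sum.cong) auto
      then show ?thesis
        using W_sum[of "k u" \<omega>] k[OF that(1)] that(2) by simp
    qed
    then show ?thesis
      unfolding A_eq SA_def by (auto simp: space_PiM)
  qed
  moreover have "(\<lambda>\<omega>. restrict (\<lambda>i. D i \<omega>) {n}) -` SC \<inter> space M
      = (\<lambda>\<omega>. W t \<omega> - W s \<omega>) -` C \<inter> space M"
    unfolding SC_def by (auto simp: space_PiM Dn)
  ultimately show ?thesis by simp
qed

lemma increment_random_variable:
  "0 \<le> s \<Longrightarrow> 0 \<le> t \<Longrightarrow> random_variable borel (\<lambda>\<omega>. W t \<omega> - W s \<omega>)"
  by (intro borel_measurable_diff random_variable_W)

text \<open>Dynkin's argument: independence from the cylinders extends to the sigma-algebra they generate.\<close>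

lemma increment_indep_past:
  assumes st: "0 \<le> s" "s < t"
  shows "indep_set (sets (path_algebra M W {0..s}))
    (sigma_sets (space M) {(\<lambda>\<omega>. W t \<omega> - W s \<omega>) -` C \<inter> space M | C. C \<in> sets borel})"
    (is "indep_set _ (sigma_sets _ ?D)")
proof -
  have meas: "random_variable borel (\<lambda>\<omega>. W t \<omega> - W s \<omega>)"
    using st by (intro increment_random_variable) auto
  have "indep_set (cylinders {0..s}) ?D"
  proof (rule indep_setI)
    show "cylinders {0..s} \<subseteq> events"
      by (auto intro!: cylinder_in_events)
    show "?D \<subseteq> events"
      using measurable_sets[OF meas] by auto
  next
    fix a b assume "a \<in> cylinders {0..s}" "b \<in> ?D"
    then show "prob (a \<inter> b) = prob a * prob b"
      using cylinder_increment_indep[OF st, of a] by (elim CollectE exE conjE) simp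
  qed
  moreover have "Int_stable ?D"
  proof (rule Int_stableI)
    fix a b assume "a \<in> ?D" "b \<in> ?D"
    then obtain C C' where "a = (\<lambda>\<omega>. W t \<omega> - W s \<omega>) -` C \<inter> space M" "C \<in> sets borel"
       "b = (\<lambda>\<omega>. W t \<omega> - W s \<omega>) -` C' \<inter> space M" "C' \<in> sets borel"
      by blast
    then show "a \<inter> b \<in> ?D"
      by (intro CollectI exI[of _ "C \<inter> C'"]) auto
  qed
  ultimately have "indep_set (sigma_sets (space M) (cylinders {0..s})) (sigma_sets (space M) ?D)"
    by (intro indep_set_sigma_sets Int_stable_cylinders)
  then show ?thesis
    unfolding indep_set_def using path_algebra_le_cylinders
    by (elim indep_sets_mono_sets) (auto split: bool.split)
qed

lemma increment_mgf:
  assumes st: "0 \<le> s" "s < t"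
  shows "integrable M (\<lambda>\<omega>. exp (\<theta> * (W t \<omega> - W s \<omega>)))" (is ?int)
    and "expectation (\<lambda>\<omega>. exp (\<theta> * (W t \<omega> - W s \<omega>))) = exp (\<theta>\<^sup>2 * (t - s) / 2)" (is ?exp)
proof -
  let ?v = "t - s"
  have v: "?v > 0" using st by simp
  \<comment> \<open>Completing the square: tilting a centred normal density shifts its mean.\<close>
  have shift: "normal_density 0 (sqrt ?v) x * exp (\<theta> * x)
      = exp (\<theta>\<^sup>2 * ?v / 2) * normal_density (\<theta> * ?v) (sqrt ?v) x" for x
  proof -
    have "- (x - 0)\<^sup>2 / (2 * ?v) + \<theta> * x = \<theta>\<^sup>2 * ?v / 2 + - (x - \<theta> * ?v)\<^sup>2 / (2 * ?v)"
      using v by (simp add: power2_eq_square divide_simps) (simp add: algebra_simps)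
    then show ?thesis
      using v unfolding normal_density_def
      by (simp add: exp_add[symmetric] mult_ac)
  qed
  have dist: "distributed M lborel (\<lambda>\<omega>. W t \<omega> - W s \<omega>) (normal_density 0 (sqrt ?v))"
    using st by (rule normal_increments)
  have "integrable lborel (\<lambda>x. normal_density 0 (sqrt ?v) x * exp (\<theta> * x))"
    unfolding shift using v by (intro integrable_mult_right integrable_normal_density) auto
  then show ?int
    using distributed_integrable[OF dist, of "\<lambda>x. exp (\<theta> * x)"] by simp
  have "expectation (\<lambda>\<omega>. exp (\<theta> * (W t \<omega> - W s \<omega>)))
      = (\<integral>x. normal_density 0 (sqrt ?v) x * exp (\<theta> * x) \<partial>lborel)"
    using distributed_integral[OF dist, of "\<lambda>x. exp (\<theta> * x)"] by simp
  also have "\<dots> = exp (\<theta>\<^sup>2 * ?v / 2)"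
    unfolding shift using v by (simp add: integral_normal_density)
  finally show ?exp .
qed

section \<open>Exponential martingales\<close>

definition stoch_exp :: "real \<Rightarrow> real \<Rightarrow> 'a \<Rightarrow> real" where
  "stoch_exp \<theta> t \<omega> = exp (\<theta> * W t \<omega> - \<theta>\<^sup>2 * t / 2)"

lemma stoch_exp_pos [simp]: "0 < stoch_exp \<theta> t \<omega>" "0 \<le> stoch_exp \<theta> t \<omega>"
  by (simp_all add: stoch_exp_def)

lemma stoch_exp_0: "\<omega> \<in> space M \<Longrightarrow> stoch_exp \<theta> 0 \<omega> = 1"
  by (simp add: stoch_exp_def start_at_zero)

lemma stoch_exp_expectation:
  assumes "0 \<le> t"
  shows "integrable M (stoch_exp \<theta> t)" "expectation (stoch_exp \<theta> t) = 1"
proof -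
  have "has_bochner_integral M (stoch_exp \<theta> t) 1"
  proof (cases "t = 0")
    case True
    then have "has_bochner_integral M (stoch_exp \<theta> t) 1 \<longleftrightarrow> has_bochner_integral M (\<lambda>_. 1::real) 1"
      by (intro has_bochner_integral_cong) (auto simp: stoch_exp_0)
    then show ?thesis
      by (simp add: has_bochner_integral_iff prob_space)
  next
    case False
    then have t: "0 < t" using assms by simp
    have eq: "stoch_exp \<theta> t \<omega> = exp (- \<theta>\<^sup>2 * t / 2) * exp (\<theta> * (W t \<omega> - W 0 \<omega>))"
      if "\<omega> \<in> space M" for \<omega>
      using that by (simp add: stoch_exp_def start_at_zero flip: exp_add)
    have "has_bochner_integral M (\<lambda>\<omega>. exp (- \<theta>\<^sup>2 * t / 2) * exp (\<theta> * (W t \<omega> - W 0 \<omega>)))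
        (exp (- \<theta>\<^sup>2 * t / 2) * exp (\<theta>\<^sup>2 * (t - 0) / 2))"
      by (intro has_bochner_integral_mult_right)
         (use increment_mgf[of 0 t \<theta>] t in \<open>auto simp: has_bochner_integral_iff\<close>)
    then show ?thesis
      by (subst has_bochner_integral_cong[OF refl eq refl]) (simp_all flip: exp_add)
  qed
  then show "integrable M (stoch_exp \<theta> t)" "expectation (stoch_exp \<theta> t) = 1"
    by (auto simp: has_bochner_integral_iff)
qed

text \<open>Over a time step the exponential is multiplied by a factor that is independent of the past and,
  by the Gaussian moment generating function, has mean one.\<close>

lemma stoch_exp_martingale:
  assumes st: "0 \<le> s" "s \<le> t" and A: "A \<in> sets (path_algebra M W {0..s})"
  shows "(\<integral>\<omega>. stoch_exp \<theta> t \<omega> * indicator A \<omega> \<partial>M) = (\<integral>\<omega>. stoch_exp \<theta> s \<omega> * indicator A \<omega> \<partial>M)"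
proof (cases "s = t")
  case False
  then have lt: "s < t" using st by simp
  let ?F = "\<lambda>\<omega>. stoch_exp \<theta> s \<omega> * indicator A \<omega>"
  let ?I = "\<lambda>\<omega>. W t \<omega> - W s \<omega>"
  let ?G = "\<lambda>\<omega>. exp (\<theta> * ?I \<omega>)"
  let ?c = "exp (- \<theta>\<^sup>2 * (t - s) / 2)"
  have A': "A \<in> events" using A path_algebra_events[of "{0..s}"] by auto
  have F_past: "?F \<in> borel_measurable (path_algebra M W {0..s})"
    unfolding stoch_exp_def
    by (intro borel_measurable_times borel_measurable_indicator A
        borel_measurable_exp[THEN measurable_compose_rev] borel_measurable_diff
        borel_measurable_const measurable_W_path_algebra) (use st in auto)
  have intF: "integrable M ?F"
    by (intro integrable_real_mult_indicator A' stoch_exp_expectation st)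
  have intG: "integrable M ?G"
    using increment_mgf[OF st(1) lt] by simp
  have "indep_var borel ?F borel ?G"
    unfolding indep_var_eq
  proof (intro conjI)
    show "random_variable borel ?F" "random_variable borel ?G"
      using intF intG by auto
    have sub1: "sigma_sets (space M) {?F -` B \<inter> space M | B. B \<in> sets borel}
        \<subseteq> sets (path_algebra M W {0..s})"
    proof -
      have "?F -` B \<inter> space M \<in> sets (path_algebra M W {0..s})" if "B \<in> sets borel" for B
        using measurable_sets[OF F_past that] by simp
      then show ?thesis
        using sets.sigma_sets_subset[of "{?F -` B \<inter> space M | B. B \<in> sets borel}"
            "path_algebra M W {0..s}"] by auto
    qed
    have sub2: "sigma_sets (space M) {?G -` B \<inter> space M | B. B \<in> sets borel}
        \<subseteq> sigma_sets (space M) {?I -` C \<inter> space M | C. C \<in> sets borel}"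
    proof (rule sigma_sets_mono', clarify)
      fix B :: "real set" assume "B \<in> sets borel"
      moreover have "(\<lambda>x::real. exp (\<theta> * x)) \<in> borel_measurable borel" by measurable
      ultimately have "(\<lambda>x. exp (\<theta> * x)) -` B \<in> sets borel"
        using measurable_sets[of "\<lambda>x. exp (\<theta> * x)" borel borel B] by simp
      moreover have "?G -` B \<inter> space M = ?I -` ((\<lambda>x. exp (\<theta> * x)) -` B) \<inter> space M" by auto
      ultimately show "\<exists>C. ?G -` B \<inter> space M = ?I -` C \<inter> space M \<and> C \<in> sets borel" by blast
    qed
    show "indep_set (sigma_sets (space M) {?F -` B \<inter> space M | B. B \<in> sets borel})
       (sigma_sets (space M) {?G -` B \<inter> space M | B. B \<in> sets borel})"
      using increment_indep_past[OF st(1) lt] unfolding indep_set_def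
      by (rule indep_sets_mono_sets) (use sub1 sub2 in \<open>auto split: bool.split\<close>)
  qed
  then have "expectation (\<lambda>\<omega>. ?F \<omega> * ?G \<omega>) = expectation ?F * expectation ?G"
    by (intro indep_var_lebesgue_integral intF intG)
  also have "expectation ?G = exp (\<theta>\<^sup>2 * (t - s) / 2)"
    using increment_mgf[OF st(1) lt] by simp
  finally have FG: "expectation (\<lambda>\<omega>. ?F \<omega> * ?G \<omega>) = expectation ?F * exp (\<theta>\<^sup>2 * (t - s) / 2)" .
  have "stoch_exp \<theta> t \<omega> * indicator A \<omega> = ?c * (?F \<omega> * ?G \<omega>)" for \<omega>
  proof -
    have "\<theta> * W t \<omega> - \<theta>\<^sup>2 * t / 2
        = - \<theta>\<^sup>2 * (t - s) / 2 + (\<theta> * W s \<omega> - \<theta>\<^sup>2 * s / 2) + \<theta> * ?I \<omega>"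
      by (simp add: field_simps)
    then have "stoch_exp \<theta> t \<omega> = ?c * stoch_exp \<theta> s \<omega> * ?G \<omega>"
      unfolding stoch_exp_def by (simp only: exp_add)
    then show ?thesis by (simp only: mult_ac)
  qed
  then have "expectation (\<lambda>\<omega>. stoch_exp \<theta> t \<omega> * indicator A \<omega>)
      = ?c * (expectation ?F * exp (\<theta>\<^sup>2 * (t - s) / 2))"
    by (simp only: FG integral_mult_right_zero)
  also have "\<dots> = expectation ?F"
    by (simp add: mult_ac flip: exp_add)
  finally show ?thesis .
qed simp

end

section \<open>Optional stopping\<close>

text \<open>A bound on second moments makes the sequence uniformly integrable, which is what exchanging limit and
  integral needs. Truncation at level \<open>C\<close> makes dominated convergence applicable and, by
  \<open>y - y\<^sup>2 / (4 C) \<le> min y C\<close>, changes the integrals by at most \<open>K / (4 C)\<close>.\<close>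

lemma (in finite_measure) integral_limit_bounded_second_moment:
  fixes F :: "nat \<Rightarrow> 'a \<Rightarrow> real"
  assumes nonneg: "\<And>n x. x \<in> space M \<Longrightarrow> 0 \<le> F n x"
    and lim: "\<And>x. x \<in> space M \<Longrightarrow> (\<lambda>n. F n x) \<longlonglongrightarrow> G x"
    and int: "\<And>n. integrable M (F n)" "\<And>n. (\<integral>x. F n x \<partial>M) = c"
    and int2: "\<And>n. integrable M (\<lambda>x. (F n x)\<^sup>2)" "\<And>n. (\<integral>x. (F n x)\<^sup>2 \<partial>M) \<le> K"
  shows "integrable M G" "(\<integral>x. G x \<partial>M) = c"
proof -
  have meas: "F n \<in> borel_measurable M" for n
    using int(1) by auto
  have measG: "G \<in> borel_measurable M"
    by (rule borel_measurable_LIMSEQ_real[OF lim meas])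
  have G_nonneg: "0 \<le> G x" if "x \<in> space M" for x
    by (rule LIMSEQ_le_const[OF lim[OF that]]) (use nonneg[OF that] in auto)
  define C :: "nat \<Rightarrow> real" where "C k = real k + 1" for k
  have C: "C k > 0" for k by (simp add: C_def)
  have lim_min: "(\<lambda>n. \<integral>x. min (F n x) (C k) \<partial>M) \<longlonglongrightarrow> (\<integral>x. min (G x) (C k) \<partial>M)" for k
  proof (rule integral_dominated_convergence[where w = "\<lambda>_. C k"])
    show "AE x in M. (\<lambda>n. min (F n x) (C k)) \<longlonglongrightarrow> min (G x) (C k)"
      using lim by (auto intro!: tendsto_min)
    show "AE x in M. norm (min (F n x) (C k)) \<le> C k" for n
      using nonneg[of _ n] C[of k] by (auto simp: min_def)
  qed (use measG meas in auto)
  have int_min: "integrable M (\<lambda>x. min (F n x) (C k))" for n k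
    by (rule Bochner_Integration.integrable_bound[OF int(1)[of n]])
      (use nonneg[of _ n] C[of k] meas[of n] in \<open>auto simp: min_def\<close>)
  have int_minG: "integrable M (\<lambda>x. min (G x) (C k))" for k
    by (rule integrable_const_bound[where B = "C k"])
      (use G_nonneg C[of k] measG in \<open>auto simp: min_def\<close>)
  have upper: "(\<integral>x. min (F n x) (C k) \<partial>M) \<le> c" for n k
    unfolding int(2)[of n, symmetric] by (intro integral_mono int int_min) auto
  have lower: "c - K / (4 * C k) \<le> (\<integral>x. min (F n x) (C k) \<partial>M)" for n k
  proof -
    have pt: "y - y\<^sup>2 / (4 * C k) \<le> min y (C k)" for y
    proof -
      have "0 \<le> (y - 2 * C k)\<^sup>2" by simp
      then have "y * (4 * C k) - y\<^sup>2 \<le> C k * (4 * C k)"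
        by (simp add: power2_eq_square algebra_simps)
      then have "y - y\<^sup>2 / (4 * C k) \<le> C k"
        using C[of k] by (simp add: field_simps)
      moreover have "0 \<le> y\<^sup>2 / (4 * C k)" using C[of k] by simp
      ultimately show ?thesis by linarith
    qed
    have "c - K / (4 * C k) \<le> c - (\<integral>x. (F n x)\<^sup>2 \<partial>M) / (4 * C k)"
      using int2(2)[of n] C[of k] by (intro diff_left_mono divide_right_mono) auto
    also have "\<dots> = (\<integral>x. F n x - (F n x)\<^sup>2 / (4 * C k) \<partial>M)"
      using int int2 by (subst Bochner_Integration.integral_diff) auto
    also have "\<dots> \<le> (\<integral>x. min (F n x) (C k) \<partial>M)"
      using int int2 by (intro integral_mono int_min pt) auto
    finally show ?thesis .
  qed
  have conv: "(\<lambda>k. \<integral>x. min (G x) (C k) \<partial>M) \<longlonglongrightarrow> c"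
  proof (rule tendsto_sandwich[of "\<lambda>k. c - K / (4 * C k)" _ _ "\<lambda>_. c"])
    show "\<forall>\<^sub>F k in sequentially. c - K / (4 * C k) \<le> (\<integral>x. min (G x) (C k) \<partial>M)"
      by (intro always_eventually allI LIMSEQ_le_const[OF lim_min]) (use lower in auto)
    show "\<forall>\<^sub>F k in sequentially. (\<integral>x. min (G x) (C k) \<partial>M) \<le> c"
      by (intro always_eventually allI LIMSEQ_le_const2[OF lim_min]) (use upper in auto)
    have "(\<lambda>k. c - K / (4 * C k)) \<longlonglongrightarrow> c - 0"
      unfolding C_def by (intro tendsto_diff tendsto_const) real_asymp
    then show "(\<lambda>k. c - K / (4 * C k)) \<longlonglongrightarrow> c" by simp
  qed simp
  have mono: "AE x in M. mono (\<lambda>k. min (G x) (C k))"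
    by (intro AE_I2 monoI) (auto simp: C_def min_def)
  have lim_C: "AE x in M. (\<lambda>k. min (G x) (C k)) \<longlonglongrightarrow> G x"
  proof (intro AE_I2 tendsto_eventually)
    fix x
    have "\<forall>\<^sub>F k in sequentially. real k \<ge> G x"
      by (rule eventually_sequentiallyI[of "nat \<lceil>G x\<rceil>"]) linarith
    then show "\<forall>\<^sub>F k in sequentially. min (G x) (C k) = G x"
      by eventually_elim (auto simp: C_def min_def)
  qed
  show "integrable M G"
    by (rule integrable_monotone_convergence[OF int_minG mono lim_C conv measG])
  show "(\<integral>x. G x \<partial>M) = c"
    by (rule integral_monotone_convergence[OF int_minG mono lim_C conv measG])
qed

context standard_brownian_motion
begin

lemma stoch_exp_continuous: "\<omega> \<in> space M \<Longrightarrow> continuous_on {0..} (\<lambda>t. stoch_exp \<theta> t \<omega>)"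
  unfolding stoch_exp_def by (intro continuous_intros continuous_paths) auto

text \<open>Stopping times of the filtration generated by \<open>W\<close>, with values in \<open>[0, \<infinity>]\<close>.\<close>

definition stopping :: "('a \<Rightarrow> ereal) \<Rightarrow> bool" where
  "stopping S \<longleftrightarrow> (\<forall>\<omega>\<in>space M. 0 \<le> S \<omega>)
    \<and> (\<forall>t\<ge>0. {\<omega> \<in> space M. S \<omega> \<le> ereal t} \<in> sets (path_algebra M W {0..t}))"

text \<open>The number of the first point of the grid \<open>0, t / (n + 1), \<dots>, t\<close> that is not before the time \<open>s\<close>.
  Rounding up a stopping time in this way yields a stopping time with finitely many values.\<close>

definition grid_index :: "ereal \<Rightarrow> real \<Rightarrow> nat \<Rightarrow> nat" where
  "grid_index s t n = (LEAST k. s \<le> ereal (t * real k / real (Suc n)))"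

lemma grid_index:
  assumes "s \<le> ereal t"
  shows "grid_index s t n \<le> Suc n"
    and "s \<le> ereal (t * real (grid_index s t n) / real (Suc n))"
    and "k < grid_index s t n \<Longrightarrow> \<not> s \<le> ereal (t * real k / real (Suc n))"
proof -
  have "s \<le> ereal (t * real (Suc n) / real (Suc n))" using assms by simp
  then show "grid_index s t n \<le> Suc n"
    "s \<le> ereal (t * real (grid_index s t n) / real (Suc n))"
    unfolding grid_index_def by (rule Least_le, rule LeastI)
qed (auto simp: grid_index_def dest: not_less_Least)

lemma stopping_events:
  assumes "stopping S" "0 \<le> t"
  shows "{\<omega> \<in> space M. S \<omega> \<le> ereal t} \<in> events"
  using assms path_algebra_events[of "{0..t}"] unfolding stopping_def by auto

text \<open>On the event that the rounded time is a given grid point, which belongs to the past of that point,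
  the martingale property replaces the value at \<open>t\<close> by the value at the grid point; the sum over the grid
  is optional stopping for the rounded time.\<close>

lemma grid_value_integral:
  assumes S: "stopping S" and t: "0 \<le> t"
  defines "F \<equiv> \<lambda>\<theta> n \<omega>. if S \<omega> \<le> ereal t
      then stoch_exp \<theta> (t * real (grid_index (S \<omega>) t n) / real (Suc n)) \<omega> else 0"
  shows "integrable M (F \<theta> n)"
    and "(\<integral>\<omega>. F \<theta> n \<omega> \<partial>M) = (\<integral>\<omega>. stoch_exp \<theta> t \<omega> * indicator {\<omega> \<in> space M. S \<omega> \<le> ereal t} \<omega> \<partial>M)"
proof -
  let ?g = "\<lambda>k. t * real k / real (Suc n)"
  let ?A = "\<lambda>k. {\<omega> \<in> space M. S \<omega> \<le> ereal (?g k)}"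
  define B where "B k = ?A k - (\<Union>j<k. ?A j)" for k
  have g: "0 \<le> ?g k" for k using t by simp
  have g_mono: "?g j \<le> ?g k" if "j \<le> k" for j k
    using t that by (intro divide_right_mono mult_left_mono) auto
  have g_le: "?g k \<le> t" if "k \<le> Suc n" for k
    using g_mono[OF that] by simp
  have A_past: "?A j \<in> sets (path_algebra M W {0..?g k})" if "j \<le> k" for j k
    using S g[of j] path_algebra_mono[of "{0..?g j}" "{0..?g k}"] g_mono[OF that]
    unfolding stopping_def by auto
  have B_past: "B k \<in> sets (path_algebra M W {0..?g k})" for k
    unfolding B_def by (intro sets.Diff sets.finite_UN A_past) auto
  have B_events: "B k \<in> events" for k
    using B_past[of k] path_algebra_events[of "{0..?g k}"] by auto
  have B_iff: "\<omega> \<in> B k \<longleftrightarrow> grid_index (S \<omega>) t n = k"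
    if "\<omega> \<in> space M" "S \<omega> \<le> ereal t" for \<omega> k
  proof -
    have "\<omega> \<in> B k \<longleftrightarrow> S \<omega> \<le> ereal (?g k) \<and> (\<forall>j<k. \<not> S \<omega> \<le> ereal (?g j))"
      using that(1) unfolding B_def by blast
    then show ?thesis
      using grid_index(2)[OF that(2), of n] grid_index(3)[OF that(2), of _ n] by (metis linorder_neqE_nat)
  qed
  have B_le: "S \<omega> \<le> ereal t" if "\<omega> \<in> B k" "k \<le> Suc n" for \<omega> k
    using that g_le[OF that(2)] order_trans[of "S \<omega>" "ereal (?g k)" "ereal t"]
    unfolding B_def by simp
  \<comment> \<open>The events \<open>B k\<close> partition \<open>S \<le> t\<close> according to the rounded time.\<close>
  have sum_B: "(\<Sum>k\<le>Suc n. f k * indicator (B k) \<omega>)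
      = (if S \<omega> \<le> ereal t then f (grid_index (S \<omega>) t n) else 0)"
    if "\<omega> \<in> space M" for \<omega> and f :: "nat \<Rightarrow> real"
  proof (cases "S \<omega> \<le> ereal t")
    case True
    then have "(\<Sum>k\<le>Suc n. f k * indicator (B k) \<omega>)
        = (\<Sum>k\<le>Suc n. if k = grid_index (S \<omega>) t n then f k else 0)"
      by (intro sum.cong) (auto simp: indicator_def B_iff[OF that True])
    then show ?thesis
      using grid_index(1)[OF True, of n] True by (simp add: sum.delta)
  next
    case False
    then have "\<forall>k\<le>Suc n. \<omega> \<notin> B k" using B_le by blast
    then show ?thesis using False by (simp add: sum.neutral)
  qed
  have F_eq: "F \<theta> n \<omega> = (\<Sum>k\<le>Suc n. stoch_exp \<theta> (?g k) \<omega> * indicator (B k) \<omega>)"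
    if "\<omega> \<in> space M" for \<omega>
    unfolding F_def sum_B[OF that] by simp
  have ind_eq: "stoch_exp \<theta> t \<omega> * indicator {\<omega> \<in> space M. S \<omega> \<le> ereal t} \<omega>
      = (\<Sum>k\<le>Suc n. stoch_exp \<theta> t \<omega> * indicator (B k) \<omega>)"
    if "\<omega> \<in> space M" for \<omega>
    unfolding sum_B[OF that] using that by auto
  have int: "integrable M (\<lambda>\<omega>. stoch_exp \<theta> s \<omega> * indicator (B k) \<omega>)" if "0 \<le> s" for k s
    using that by (intro integrable_real_mult_indicator B_events stoch_exp_expectation)
  have "integrable M (\<lambda>\<omega>. \<Sum>k\<le>Suc n. stoch_exp \<theta> (?g k) \<omega> * indicator (B k) \<omega>)"
    by (intro Bochner_Integration.integrable_sum int g)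
  then show "integrable M (F \<theta> n)"
    by (subst Bochner_Integration.integrable_cong[OF refl F_eq])
  have "(\<integral>\<omega>. F \<theta> n \<omega> \<partial>M)
      = (\<integral>\<omega>. (\<Sum>k\<le>Suc n. stoch_exp \<theta> (?g k) \<omega> * indicator (B k) \<omega>) \<partial>M)"
    by (rule Bochner_Integration.integral_cong[OF refl F_eq])
  also have "\<dots> = (\<Sum>k\<le>Suc n. \<integral>\<omega>. stoch_exp \<theta> (?g k) \<omega> * indicator (B k) \<omega> \<partial>M)"
    by (intro Bochner_Integration.integral_sum int g)
  also have "\<dots> = (\<Sum>k\<le>Suc n. \<integral>\<omega>. stoch_exp \<theta> t \<omega> * indicator (B k) \<omega> \<partial>M)"
    by (intro sum.cong refl stoch_exp_martingale[symmetric] B_past g g_le) auto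
  also have "\<dots> = (\<integral>\<omega>. (\<Sum>k\<le>Suc n. stoch_exp \<theta> t \<omega> * indicator (B k) \<omega>) \<partial>M)"
    by (intro Bochner_Integration.integral_sum[symmetric] int t)
  also have "\<dots> = (\<integral>\<omega>. stoch_exp \<theta> t \<omega> * indicator {\<omega> \<in> space M. S \<omega> \<le> ereal t} \<omega> \<partial>M)"
    by (rule Bochner_Integration.integral_cong[OF refl ind_eq[symmetric]])
  finally show "(\<integral>\<omega>. F \<theta> n \<omega> \<partial>M)
    = (\<integral>\<omega>. stoch_exp \<theta> t \<omega> * indicator {\<omega> \<in> space M. S \<omega> \<le> ereal t} \<omega> \<partial>M)" .
qed

lemma stoch_exp_square:
  "(stoch_exp \<theta> s \<omega>)\<^sup>2 = exp (\<theta>\<^sup>2 * s) * stoch_exp (2 * \<theta>) s \<omega>"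
  unfolding stoch_exp_def
  by (simp add: power2_eq_square algebra_simps flip: exp_add)

text \<open>As the grid is refined, the rounded times converge to \<open>S\<close>, so by path continuity the values at the rounded
  times converge to the value at \<open>S\<close>. The integrals converge as well because the second moments stay bounded.\<close>

lemma optional_stopping_bounded:
  assumes S: "stopping S" and t: "0 \<le> t"
  shows "integrable M (\<lambda>\<omega>. stoch_exp \<theta> (real_of_ereal (S \<omega>)) \<omega> * indicator {\<omega> \<in> space M. S \<omega> \<le> ereal t} \<omega>)"
    and "(\<integral>\<omega>. stoch_exp \<theta> (real_of_ereal (S \<omega>)) \<omega> * indicator {\<omega> \<in> space M. S \<omega> \<le> ereal t} \<omega> \<partial>M)
      = (\<integral>\<omega>. stoch_exp \<theta> t \<omega> * indicator {\<omega> \<in> space M. S \<omega> \<le> ereal t} \<omega> \<partial>M)"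
proof -
  let ?g = "\<lambda>n \<omega>. t * real (grid_index (S \<omega>) t n) / real (Suc n)"
  define F where "F \<theta> n \<omega> = (if S \<omega> \<le> ereal t then stoch_exp \<theta> (?g n \<omega>) \<omega> else 0)" for \<theta> n \<omega>
  let ?G = "\<lambda>\<omega>. stoch_exp \<theta> (real_of_ereal (S \<omega>)) \<omega> * indicator {\<omega> \<in> space M. S \<omega> \<le> ereal t} \<omega>"
  note F_int = grid_value_integral[OF S t, folded F_def]
  have g: "0 \<le> ?g n \<omega>" for n \<omega> using t by simp
  have lim: "(\<lambda>n. F \<theta> n \<omega>) \<longlonglongrightarrow> ?G \<omega>" if \<omega>: "\<omega> \<in> space M" for \<omega>
  proof (cases "S \<omega> \<le> ereal t")
    case True
    then obtain s where s: "S \<omega> = ereal s" "0 \<le> s"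
      using S \<omega> unfolding stopping_def by (cases "S \<omega>") auto
    have close: "\<bar>?g n \<omega> - s\<bar> \<le> t / real (Suc n)" for n
    proof (cases "grid_index (S \<omega>) t n")
      case 0
      then show ?thesis
        using grid_index(2)[OF True, of n] s t by simp
    next
      case (Suc k)
      have "t * real k / real (Suc n) < s" "s \<le> ?g n \<omega>"
        using grid_index(3)[OF True, of k n] grid_index(2)[OF True, of n] s Suc by auto
      moreover have "?g n \<omega> = t * real k / real (Suc n) + t / real (Suc n)"
      proof -
        have "real (Suc k) = real k + 1" by simp
        then show ?thesis
          unfolding Suc by (simp only: distrib_left add_divide_distrib mult_1_right)
      qed
      ultimately show ?thesis by linarith
    qed
    have "(\<lambda>n. ?g n \<omega> - s) \<longlonglongrightarrow> 0"
    proof (rule Lim_null_comparison)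
      show "\<forall>\<^sub>F n in sequentially. norm (?g n \<omega> - s) \<le> t / real (Suc n)"
        using close by (intro always_eventually) auto
      show "(\<lambda>n. t / real (Suc n)) \<longlonglongrightarrow> 0" by real_asymp
    qed
    then have "(\<lambda>n. ?g n \<omega>) \<longlonglongrightarrow> s" by (rule LIM_zero_cancel)
    then have "(\<lambda>n. stoch_exp \<theta> (?g n \<omega>) \<omega>) \<longlonglongrightarrow> stoch_exp \<theta> s \<omega>"
      using g s(2) by (intro continuous_on_tendsto_compose[OF stoch_exp_continuous[OF \<omega>]]) auto
    then show ?thesis
      using True \<omega> s by (simp add: F_def)
  next
    case False
    then show ?thesis by (simp add: F_def)
  qed
  \<comment> \<open>The square of a stochastic exponential is, up to a bounded factor, a stochastic exponential,
    whose expectation along the grid is again preserved.\<close>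
  have sq_le: "(F \<theta> n \<omega>)\<^sup>2 \<le> exp (\<theta>\<^sup>2 * t) * F (2 * \<theta>) n \<omega>" for n \<omega>
  proof (cases "S \<omega> \<le> ereal t")
    case True
    have "?g n \<omega> \<le> t * real (Suc n) / real (Suc n)"
      using grid_index(1)[OF True, of n] t by (intro divide_right_mono mult_left_mono) auto
    then have "\<theta>\<^sup>2 * ?g n \<omega> \<le> \<theta>\<^sup>2 * t" by (intro mult_left_mono) auto
    then have "exp (\<theta>\<^sup>2 * ?g n \<omega>) \<le> exp (\<theta>\<^sup>2 * t)" by simp
    then show ?thesis
      unfolding F_def using True
      by (simp only: if_True stoch_exp_square) (intro mult_right_mono, auto)
  qed (simp add: F_def)
  have meas: "F \<theta> n \<in> borel_measurable M" for n \<theta>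
    using F_int(1)[of \<theta> n] by auto
  have int2: "integrable M (\<lambda>\<omega>. (F \<theta> n \<omega>)\<^sup>2)" for n
    by (rule Bochner_Integration.integrable_bound[OF integrable_mult_right[OF F_int(1)[of "2 * \<theta>" n], of "exp (\<theta>\<^sup>2 * t)"]])
      (use sq_le[of n] meas in \<open>auto intro!: AE_I2 order_trans[OF _ abs_ge_self]\<close>)
  have bound: "(\<integral>\<omega>. (F \<theta> n \<omega>)\<^sup>2 \<partial>M) \<le> exp (\<theta>\<^sup>2 * t)" for n
  proof -
    have "(\<integral>\<omega>. (F \<theta> n \<omega>)\<^sup>2 \<partial>M) \<le> (\<integral>\<omega>. exp (\<theta>\<^sup>2 * t) * F (2 * \<theta>) n \<omega> \<partial>M)"
      by (intro integral_mono int2 sq_le integrable_mult_right F_int)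
    also have "\<dots> = exp (\<theta>\<^sup>2 * t)
        * (\<integral>\<omega>. stoch_exp (2 * \<theta>) t \<omega> * indicator {\<omega> \<in> space M. S \<omega> \<le> ereal t} \<omega> \<partial>M)"
      by (simp add: F_int(2))
    also have "\<dots> \<le> exp (\<theta>\<^sup>2 * t) * (\<integral>\<omega>. stoch_exp (2 * \<theta>) t \<omega> \<partial>M)"
      by (intro mult_left_mono integral_mono integrable_real_mult_indicator stopping_events S t
          stoch_exp_expectation) (auto simp: indicator_def)
    finally show ?thesis
      by (simp add: stoch_exp_expectation(2)[OF t])
  qed
  have F_nonneg: "0 \<le> F \<theta> n \<omega>" for n \<omega>
    by (simp add: F_def)
  show "integrable M ?G"
    by (rule integral_limit_bounded_second_moment(1)[OF F_nonneg lim F_int int2 bound])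
  show "(\<integral>\<omega>. ?G \<omega> \<partial>M)
      = (\<integral>\<omega>. stoch_exp \<theta> t \<omega> * indicator {\<omega> \<in> space M. S \<omega> \<le> ereal t} \<omega> \<partial>M)"
    by (rule integral_limit_bounded_second_moment(2)[OF F_nonneg lim F_int int2 bound])
qed

text \<open>Letting the horizon tend to infinity. The limit may be strictly smaller than one: what is missing is the
  mass of the tilted law on \<open>S = \<infinity>\<close>.\<close>

lemma optional_stopping:
  assumes S: "stopping S"
  shows "integrable M (\<lambda>\<omega>. stoch_exp \<theta> (real_of_ereal (S \<omega>)) \<omega> * indicator {\<omega>. S \<omega> < \<infinity>} \<omega>)"
      (is "integrable M ?G")
    and "(\<lambda>n. \<integral>\<omega>. stoch_exp \<theta> (real n) \<omega> * indicator {\<omega> \<in> space M. S \<omega> \<le> ereal (real n)} \<omega> \<partial>M)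
      \<longlonglongrightarrow> (\<integral>\<omega>. stoch_exp \<theta> (real_of_ereal (S \<omega>)) \<omega> * indicator {\<omega>. S \<omega> < \<infinity>} \<omega> \<partial>M)"
proof -
  define F where "F n \<omega> = stoch_exp \<theta> (real_of_ereal (S \<omega>)) \<omega>
    * indicator {\<omega> \<in> space M. S \<omega> \<le> ereal (real n)} \<omega>" for n \<omega>
  have int: "integrable M (F n)" for n
    unfolding F_def by (intro optional_stopping_bounded S) simp
  have F_eq: "(\<integral>\<omega>. F n \<omega> \<partial>M)
      = (\<integral>\<omega>. stoch_exp \<theta> (real n) \<omega> * indicator {\<omega> \<in> space M. S \<omega> \<le> ereal (real n)} \<omega> \<partial>M)" for n
    unfolding F_def by (intro optional_stopping_bounded S) simp
  have F_mono: "F m \<omega> \<le> F n \<omega>" if "m \<le> n" for m n \<omega>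
    using that order_trans[of "S \<omega>" "ereal (real m)" "ereal (real n)"]
    by (auto simp: F_def indicator_def)
  have F_lim: "(\<lambda>n. F n \<omega>) \<longlonglongrightarrow> ?G \<omega>" if \<omega>: "\<omega> \<in> space M" for \<omega>
  proof (cases "S \<omega> < \<infinity>")
    case True
    then obtain s where s: "S \<omega> = ereal s"
      using S \<omega> unfolding stopping_def by (cases "S \<omega>") auto
    have "\<forall>\<^sub>F n in sequentially. s \<le> real n"
      by (rule eventually_sequentiallyI[of "nat \<lceil>s\<rceil>"]) linarith
    then have "\<forall>\<^sub>F n in sequentially. F n \<omega> = ?G \<omega>"
      by eventually_elim (use s \<omega> in \<open>auto simp: F_def\<close>)
    then show ?thesis by (rule tendsto_eventually)
  next
    case False
    then show ?thesis by (auto simp: F_def)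
  qed
  have "(\<integral>\<omega>. F n \<omega> \<partial>M) \<le> 1" for n
  proof -
    have "(\<integral>\<omega>. F n \<omega> \<partial>M) \<le> (\<integral>\<omega>. stoch_exp \<theta> (real n) \<omega> \<partial>M)"
      unfolding F_eq by (intro integral_mono integrable_real_mult_indicator stopping_events S
          stoch_exp_expectation) (auto simp: indicator_def)
    then show ?thesis by (simp add: stoch_exp_expectation)
  qed
  moreover have "incseq (\<lambda>n. \<integral>\<omega>. F n \<omega> \<partial>M)"
    by (intro incseq_SucI integral_mono int F_mono) auto
  ultimately obtain L where L: "(\<lambda>n. \<integral>\<omega>. F n \<omega> \<partial>M) \<longlonglongrightarrow> L"
    using incseq_convergent by blast
  have mono: "AE \<omega> in M. mono (\<lambda>n. F n \<omega>)"
    using F_mono by (auto intro!: AE_I2 monoI)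
  have lim: "AE \<omega> in M. (\<lambda>n. F n \<omega>) \<longlonglongrightarrow> ?G \<omega>"
    using F_lim by auto
  have meas: "?G \<in> borel_measurable M"
    by (rule borel_measurable_LIMSEQ_real[OF F_lim]) (use int in auto)
  show "integrable M ?G"
    by (rule integrable_monotone_convergence[OF int mono lim L meas])
  show "(\<lambda>n. \<integral>\<omega>. stoch_exp \<theta> (real n) \<omega> * indicator {\<omega> \<in> space M. S \<omega> \<le> ereal (real n)} \<omega> \<partial>M)
      \<longlonglongrightarrow> (\<integral>\<omega>. ?G \<omega> \<partial>M)"
    using L integral_monotone_convergence[OF int mono lim L meas] by (simp add: F_eq)
qed

end

section \<open>Zeros of continuous paths as stopping times\<close>

definition hitting_time :: "(real \<Rightarrow> real) \<Rightarrow> ereal" where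
  "hitting_time f = Inf {ereal t | t. 0 \<le> t \<and> f t = 0}"

text \<open>The zeros of a continuous function form a closed set, so the infimum is attained.\<close>

lemma hitting_time_cases:
  assumes "continuous_on {0..} f"
  obtains (never) "hitting_time f = \<infinity>" "\<And>s. 0 \<le> s \<Longrightarrow> f s \<noteq> 0"
  | (hit) \<tau> where "hitting_time f = ereal \<tau>" "0 \<le> \<tau>" "f \<tau> = 0"
      "\<And>s. 0 \<le> s \<Longrightarrow> s < \<tau> \<Longrightarrow> f s \<noteq> 0"
proof (cases "\<exists>s\<ge>0. f s = 0")
  case False
  then have "{ereal t | t. 0 \<le> t \<and> f t = 0} = {}" by auto
  then have "hitting_time f = \<infinity>"
    by (simp only: hitting_time_def Inf_empty top_ereal_def)
  then show ?thesis using never False by blast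
next
  case True
  let ?Z = "{0..} \<inter> f -` {0}"
  have closed: "closed ?Z"
    by (rule continuous_closed_preimage[OF assms]) auto
  have ne: "?Z \<noteq> {}" using True by auto
  have bdd: "bdd_below ?Z" by (intro bdd_belowI[of _ 0]) auto
  have mem: "Inf ?Z \<in> ?Z"
    by (rule closed_contains_Inf[OF ne bdd closed])
  have low: "Inf ?Z \<le> s" if "0 \<le> s" "f s = 0" for s
    using that by (intro cInf_lower bdd) auto
  have "hitting_time f = ereal (Inf ?Z)"
    unfolding hitting_time_def
  proof (rule antisym)
    show "Inf {ereal t | t. 0 \<le> t \<and> f t = 0} \<le> ereal (Inf ?Z)"
      using mem by (intro Inf_lower) auto
    show "ereal (Inf ?Z) \<le> Inf {ereal t | t. 0 \<le> t \<and> f t = 0}"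
      by (intro Inf_greatest) (use low in auto)
  qed
  then show ?thesis
    using hit[of "Inf ?Z"] mem low by (metis IntE atLeast_iff not_le vimage_singleton_eq)
qed

lemma hitting_time_le_iff:
  assumes "continuous_on {0..} f"
  shows "hitting_time f \<le> ereal t \<longleftrightarrow> (\<exists>s\<in>{0..t}. f s = 0)"
  using assms by (cases rule: hitting_time_cases) (auto simp: not_less[symmetric])

lemma hitting_time_nonneg: "0 \<le> hitting_time f"
  unfolding hitting_time_def by (intro Inf_greatest) auto

text \<open>By compactness of \<open>[0, t]\<close>, a continuous path has a zero there as soon as it takes arbitrarily small
  values on a countable dense set of times, and the latter is a countable combination of events of the past.\<close>

lemma (in standard_brownian_motion) hitting_time_stopping:
  assumes cont: "\<And>\<omega>. \<omega> \<in> space M \<Longrightarrow> continuous_on {0..} (\<lambda>t. f t \<omega>)"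
    and meas: "\<And>I s. s \<in> I \<Longrightarrow> f s \<in> borel_measurable (path_algebra M W I)"
  shows "stopping (\<lambda>\<omega>. hitting_time (\<lambda>t. f t \<omega> :: real))"
  unfolding stopping_def
proof (intro conjI allI impI ballI hitting_time_nonneg)
  fix t :: real assume t: "0 \<le> t"
  let ?P = "path_algebra M W {0..t}"
  obtain D where D: "countable D" "D \<subseteq> {0..t}" "{0..t} \<subseteq> closure D"
    by (rule separable)
  have "hitting_time (\<lambda>t. f t \<omega>) \<le> ereal t \<longleftrightarrow> (\<forall>n. \<exists>r\<in>D. \<bar>f r \<omega>\<bar> < 1 / real (Suc n))"
    if \<omega>: "\<omega> \<in> space M" for \<omega>
    unfolding hitting_time_le_iff[OF cont[OF \<omega>]]
  proof (intro iffI allI)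
    fix n assume "\<exists>s\<in>{0..t}. f s \<omega> = 0"
    then obtain s where s: "s \<in> {0..t}" "f s \<omega> = 0" by blast
    from cont[OF \<omega>] s(1) obtain d where d: "d > 0"
      "\<And>r. 0 \<le> r \<Longrightarrow> dist r s < d \<Longrightarrow> dist (f r \<omega>) (f s \<omega>) < 1 / real (Suc n)"
      unfolding continuous_on_iff using zero_less_divide_1_iff[of "real (Suc n)"]
      by (metis atLeastAtMost_iff atLeast_iff of_nat_0_less_iff zero_less_Suc)
    obtain r where "r \<in> D" "dist r s < d"
      using D(3) s(1) d(1) by (meson closure_approachable subsetD)
    then show "\<exists>r\<in>D. \<bar>f r \<omega>\<bar> < 1 / real (Suc n)"
      using d(2)[of r] D(2) s(2) by (intro bexI[of _ r]) (auto simp: dist_real_def)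
  next
    assume *: "\<forall>n. \<exists>r\<in>D. \<bar>f r \<omega>\<bar> < 1 / real (Suc n)"
    have "continuous_on {0..t} (\<lambda>s. \<bar>f s \<omega>\<bar>)"
      by (intro continuous_on_rabs continuous_on_subset[OF cont[OF \<omega>]]) auto
    then obtain s where s: "s \<in> {0..t}" "\<And>r. r \<in> {0..t} \<Longrightarrow> \<bar>f s \<omega>\<bar> \<le> \<bar>f r \<omega>\<bar>"
      using continuous_attains_inf[of "{0..t}" "\<lambda>s. \<bar>f s \<omega>\<bar>"] t by auto
    have "f s \<omega> = 0"
    proof (rule ccontr)
      assume "f s \<omega> \<noteq> 0"
      then obtain n where "1 / real (Suc n) < \<bar>f s \<omega>\<bar>"
        using nat_approx_posE[of "\<bar>f s \<omega>\<bar>"] by auto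
      moreover obtain r where "r \<in> D" "\<bar>f r \<omega>\<bar> < 1 / real (Suc n)" using * by blast
      ultimately show False using s(2)[of r] D(2) by (smt (verit) subsetD)
    qed
    then show "\<exists>s\<in>{0..t}. f s \<omega> = 0" using s(1) by blast
  qed
  then have "{\<omega> \<in> space M. hitting_time (\<lambda>t. f t \<omega>) \<le> ereal t}
      = {\<omega> \<in> space ?P. \<forall>n. \<exists>r\<in>D. \<bar>f r \<omega>\<bar> < 1 / real (Suc n)}"
    by auto
  also have "\<dots> \<in> sets ?P"
  proof (intro sets.sets_Collect_countable_All sets.sets_Collect_countable_Ex' D(1))
    fix n r assume "r \<in> D"
    then have [measurable]: "f r \<in> borel_measurable ?P" using D(2) by (intro meas) auto
    show "{\<omega> \<in> space ?P. \<bar>f r \<omega>\<bar> < 1 / real (Suc n)} \<in> sets ?P"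
      by measurable
  qed
  finally show "{\<omega> \<in> space M. hitting_time (\<lambda>t. f t \<omega>) \<le> ereal t} \<in> sets ?P" .
qed

lemma (in standard_brownian_motion) stopping_min:
  assumes "stopping S" "stopping S'"
  shows "stopping (\<lambda>\<omega>. min (S \<omega>) (S' \<omega>))"
  unfolding stopping_def
proof (intro conjI ballI allI impI)
  fix t :: real assume "0 \<le> t"
  have "{\<omega> \<in> space M. min (S \<omega>) (S' \<omega>) \<le> ereal t}
      = {\<omega> \<in> space M. S \<omega> \<le> ereal t} \<union> {\<omega> \<in> space M. S' \<omega> \<le> ereal t}"
    by (auto simp: min_le_iff_disj)
  moreover have "{\<omega> \<in> space M. S \<omega> \<le> ereal t} \<in> sets (path_algebra M W {0..t})"
    "{\<omega> \<in> space M. S' \<omega> \<le> ereal t} \<in> sets (path_algebra M W {0..t})"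
    using assms \<open>0 \<le> t\<close> unfolding stopping_def by blast+
  ultimately show "{\<omega> \<in> space M. min (S \<omega>) (S' \<omega>) \<le> ereal t} \<in> sets (path_algebra M W {0..t})"
    by (simp only: sets.Un)
qed (use assms in \<open>auto simp: stopping_def\<close>)

section \<open>Measurability at stopping times\<close>

lemma (in standard_brownian_motion) stopping_random_variable:
  assumes "stopping S"
  shows "random_variable borel S"
proof (rule borel_measurableI_le)
  fix y :: ereal
  show "{\<omega> \<in> space M. S \<omega> \<le> y} \<in> events"
  proof (cases "0 \<le> y \<and> y \<noteq> \<infinity>")
    case True
    then obtain t where "y = ereal t" "0 \<le> t" by (cases y) auto
    then show ?thesis using stopping_events[OF assms] by simp
  next
    case False
    then have "{\<omega> \<in> space M. S \<omega> \<le> y} = {} \<or> {\<omega> \<in> space M. S \<omega> \<le> y} = space M"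
      using assms unfolding stopping_def by (auto dest: order_trans)
    then show ?thesis by (elim disjE) (simp_all only: sets.empty_sets sets.top)
  qed
qed

text \<open>The stopped exponential is measurable as an integrable function, and \<open>W\<close> at the stopping time is
  recovered from it by a logarithm.\<close>

lemma (in standard_brownian_motion) stopped_W_random_variable:
  assumes S: "stopping S"
  shows "random_variable borel (\<lambda>\<omega>. W (real_of_ereal (S \<omega>)) \<omega> * indicator {\<omega>. S \<omega> < \<infinity>} \<omega>)"
proof -
  let ?E = "\<lambda>\<omega>. stoch_exp 1 (real_of_ereal (S \<omega>)) \<omega> * indicator {\<omega>. S \<omega> < \<infinity>} \<omega>"
  note [measurable] = stopping_random_variable[OF S]
  have [measurable]: "random_variable borel ?E"
    using optional_stopping(1)[OF S, of 1] by auto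
  have "W (real_of_ereal (S \<omega>)) \<omega> * indicator {\<omega>. S \<omega> < \<infinity>} \<omega>
      = (if S \<omega> < \<infinity> then ln (?E \<omega>) + real_of_ereal (S \<omega>) / 2 else 0)" for \<omega>
    by (simp add: stoch_exp_def)
  then show ?thesis by (subst measurable_cong, assumption) measurable
qed

section \<open>The process in the quadrant and its exit\<close>

definition kernel :: "real \<Rightarrow> real \<Rightarrow> real \<Rightarrow> real" where
  "kernel \<gamma> a b = (a - b)\<^sup>2 / 2 + (1 - \<gamma>) * a + \<gamma> * b"

text \<open>The smaller root \<open>a\<close> of \<open>kernel \<gamma> a b = 0\<close>: the real version of \<open>Pminus\<close>.\<close>

definition p_minus :: "real \<Rightarrow> real \<Rightarrow> real" where
  "p_minus \<gamma> b = \<gamma> - 1 + b - sqrt ((1 - \<gamma>)\<^sup>2 - 2 * b)"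

lemma kernel_p_minus:
  assumes "b \<le> (1 - \<gamma>)\<^sup>2 / 2"
  shows "kernel \<gamma> (p_minus \<gamma> b) b = 0"
proof -
  define r where "r = sqrt ((1 - \<gamma>)\<^sup>2 - 2 * b)"
  have "2 * kernel \<gamma> (p_minus \<gamma> b) b = r\<^sup>2 - ((1 - \<gamma>)\<^sup>2 - 2 * b)"
    unfolding kernel_def p_minus_def r_def[symmetric]
    by (simp add: power2_eq_square field_simps)
  also have "\<dots> = 0"
    using assms by (simp add: r_def)
  finally show ?thesis by simp
qed

lemma fst_Z: "fst (Z W \<gamma> (x0, y0) t \<omega>) = x0 - W t \<omega> + t * (1 - \<gamma>)"
  and snd_Z: "snd (Z W \<gamma> (x0, y0) t \<omega>) = y0 + W t \<omega> + t * \<gamma>"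
  by (simp_all add: Z_def driftW_def)

text \<open>The sum of the coordinates is \<open>x0 + y0 + t\<close>, so on the vertical axis the second coordinate is positive by itself.\<close>

lemma T1_eq_hitting_time:
  assumes "0 < x0" "0 < y0"
  shows "T1 W \<gamma> (x0, y0) \<omega> = hitting_time (\<lambda>t. fst (Z W \<gamma> (x0, y0) t \<omega>))"
proof -
  have "Z W \<gamma> (x0, y0) t \<omega> \<in> {0} \<times> {0..} \<longleftrightarrow> fst (Z W \<gamma> (x0, y0) t \<omega>) = 0" if "0 \<le> t" for t
    using that assms fst_Z[of W \<gamma> x0 y0 t \<omega>] snd_Z[of W \<gamma> x0 y0 t \<omega>]
    by (auto simp: mem_Times_iff algebra_simps)
  then show ?thesis
    unfolding T1_def hitting_time_def by (intro arg_cong[where f = Inf]) auto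
qed

lemma T2_eq_hitting_time:
  assumes "0 < x0" "0 < y0"
  shows "T2 W \<gamma> (x0, y0) \<omega> = hitting_time (\<lambda>t. snd (Z W \<gamma> (x0, y0) t \<omega>))"
proof -
  have "Z W \<gamma> (x0, y0) t \<omega> \<in> {0..} \<times> {0} \<longleftrightarrow> snd (Z W \<gamma> (x0, y0) t \<omega>) = 0" if "0 \<le> t" for t
    using that assms fst_Z[of W \<gamma> x0 y0 t \<omega>] snd_Z[of W \<gamma> x0 y0 t \<omega>]
    by (auto simp: mem_Times_iff algebra_simps)
  then show ?thesis
    unfolding T2_def hitting_time_def by (intro arg_cong[where f = Inf]) auto
qed

locale quadrant_process = standard_brownian_motion M W
  for M :: "'a measure" and W :: "real \<Rightarrow> 'a \<Rightarrow> real" +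
  fixes \<gamma> x0 y0 :: real
  assumes \<gamma>: "0 < \<gamma>" "\<gamma> < 1" and x0: "0 < x0" and y0: "0 < y0"
begin

abbreviation X :: "real \<Rightarrow> 'a \<Rightarrow> real" where "X t \<omega> \<equiv> fst (Z W \<gamma> (x0, y0) t \<omega>)"
abbreviation Y :: "real \<Rightarrow> 'a \<Rightarrow> real" where "Y t \<omega> \<equiv> snd (Z W \<gamma> (x0, y0) t \<omega>)"
abbreviation \<tau>1 :: "'a \<Rightarrow> ereal" where "\<tau>1 \<equiv> T1 W \<gamma> (x0, y0)"
abbreviation \<tau>2 :: "'a \<Rightarrow> ereal" where "\<tau>2 \<equiv> T2 W \<gamma> (x0, y0)"
abbreviation \<tau> :: "'a \<Rightarrow> ereal" where "\<tau> \<equiv> T W \<gamma> (x0, y0)"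
abbreviation X\<tau> :: "('a \<Rightarrow> ereal) \<Rightarrow> 'a \<Rightarrow> real" where "X\<tau> \<equiv> X_at W \<gamma> (x0, y0)"
abbreviation Y\<tau> :: "('a \<Rightarrow> ereal) \<Rightarrow> 'a \<Rightarrow> real" where "Y\<tau> \<equiv> Y_at W \<gamma> (x0, y0)"

lemma X_continuous: "\<omega> \<in> space M \<Longrightarrow> continuous_on {0..} (\<lambda>t. X t \<omega>)"
  unfolding fst_Z by (intro continuous_intros continuous_paths)

lemma Y_continuous: "\<omega> \<in> space M \<Longrightarrow> continuous_on {0..} (\<lambda>t. Y t \<omega>)"
  unfolding snd_Z by (intro continuous_intros continuous_paths)

lemma XY_start: "\<omega> \<in> space M \<Longrightarrow> X 0 \<omega> = x0" "\<omega> \<in> space M \<Longrightarrow> Y 0 \<omega> = y0"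
  by (simp_all add: fst_Z snd_Z start_at_zero)

lemma XY_sum: "X t \<omega> + Y t \<omega> = x0 + y0 + t"
  by (simp add: fst_Z snd_Z algebra_simps)

lemma stopping_\<tau>1: "stopping \<tau>1"
  unfolding T1_eq_hitting_time[OF x0 y0, abs_def]
proof (rule hitting_time_stopping[OF X_continuous])
  fix I and s :: real assume "s \<in> I"
  then show "X s \<in> borel_measurable (path_algebra M W I)"
    using measurable_W_path_algebra[of s I] unfolding fst_Z by measurable
qed

lemma stopping_\<tau>2: "stopping \<tau>2"
  unfolding T2_eq_hitting_time[OF x0 y0, abs_def]
proof (rule hitting_time_stopping[OF Y_continuous])
  fix I and s :: real assume "s \<in> I"
  then show "Y s \<in> borel_measurable (path_algebra M W I)"
    using measurable_W_path_algebra[of s I] unfolding snd_Z by measurable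
qed

lemma stopping_\<tau>: "stopping \<tau>"
  unfolding T_def[abs_def] by (rule stopping_min[OF stopping_\<tau>1 stopping_\<tau>2])

lemma \<tau>1_hit:
  assumes "\<omega> \<in> space M" "\<tau>1 \<omega> < \<infinity>"
  obtains t where "\<tau>1 \<omega> = ereal t" "0 \<le> t" "X t \<omega> = 0" "0 < Y t \<omega>"
  using X_continuous[OF assms(1)]
proof (cases rule: hitting_time_cases)
  case never
  then show ?thesis using assms(2) unfolding T1_eq_hitting_time[OF x0 y0] by simp
next
  case (hit t)
  then show ?thesis
    using that[of t] XY_sum[of t \<omega>] x0 y0 unfolding T1_eq_hitting_time[OF x0 y0] by simp
qed

lemma \<tau>2_hit:
  assumes "\<omega> \<in> space M" "\<tau>2 \<omega> < \<infinity>"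
  obtains t where "\<tau>2 \<omega> = ereal t" "0 \<le> t" "Y t \<omega> = 0" "0 < X t \<omega>"
  using Y_continuous[OF assms(1)]
proof (cases rule: hitting_time_cases)
  case never
  then show ?thesis using assms(2) unfolding T2_eq_hitting_time[OF x0 y0] by simp
next
  case (hit t)
  then show ?thesis
    using that[of t] XY_sum[of t \<omega>] x0 y0 unfolding T2_eq_hitting_time[OF x0 y0] by simp
qed

text \<open>The sum of the coordinates stays positive, so they cannot vanish simultaneously and the two hitting times
  differ unless both are infinite.\<close>

lemma exit_cases:
  assumes \<omega>: "\<omega> \<in> space M"
  obtains (never) "\<tau> \<omega> = \<infinity>" "\<tau>1 \<omega> = \<infinity>" "\<tau>2 \<omega> = \<infinity>"
  | (left) "\<tau> \<omega> = \<tau>1 \<omega>" "\<tau>1 \<omega> < \<tau>2 \<omega>" "\<tau>1 \<omega> < \<infinity>" "X\<tau> \<tau> \<omega> = 0" "Y\<tau> \<tau> \<omega> = Y\<tau> \<tau>1 \<omega>" "0 < Y\<tau> \<tau>1 \<omega>"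
  | (bottom) "\<tau> \<omega> = \<tau>2 \<omega>" "\<tau>2 \<omega> < \<tau>1 \<omega>" "\<tau>2 \<omega> < \<infinity>" "Y\<tau> \<tau> \<omega> = 0" "X\<tau> \<tau> \<omega> = X\<tau> \<tau>2 \<omega>" "0 < X\<tau> \<tau>2 \<omega>"
proof -
  consider "\<tau>1 \<omega> < \<tau>2 \<omega>" | "\<tau>2 \<omega> < \<tau>1 \<omega>" | "\<tau>1 \<omega> = \<tau>2 \<omega>" "\<tau>1 \<omega> < \<infinity>" | "\<tau>1 \<omega> = \<tau>2 \<omega>" "\<tau>1 \<omega> = \<infinity>"
    by (metis ereal_infty_less(1) linorder_neqE)
  then show ?thesis
  proof cases
    case 1
    then have fin: "\<tau>1 \<omega> < \<infinity>" by (rule less_le_trans) simp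
    obtain t where t: "\<tau>1 \<omega> = ereal t" "X t \<omega> = 0" "0 < Y t \<omega>"
      using \<tau>1_hit[OF \<omega> fin] by blast
    have T: "\<tau> \<omega> = \<tau>1 \<omega>" using 1 by (auto simp: T_def min_def)
    show ?thesis
      by (rule left) (use 1 fin T t in \<open>simp_all add: X_at_def Y_at_def\<close>)
  next
    case 2
    then have fin: "\<tau>2 \<omega> < \<infinity>" by (rule less_le_trans) simp
    obtain t where t: "\<tau>2 \<omega> = ereal t" "Y t \<omega> = 0" "0 < X t \<omega>"
      using \<tau>2_hit[OF \<omega> fin] by blast
    have T: "\<tau> \<omega> = \<tau>2 \<omega>" using 2 by (auto simp: T_def min_def)
    show ?thesis
      by (rule bottom) (use 2 fin T t in \<open>simp_all add: X_at_def Y_at_def\<close>)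
  next
    case 3
    obtain t where "\<tau>1 \<omega> = ereal t" "0 < Y t \<omega>" using \<tau>1_hit[OF \<omega>] 3 by auto
    moreover obtain s where "\<tau>2 \<omega> = ereal s" "Y s \<omega> = 0" using \<tau>2_hit[OF \<omega>] 3 by auto
    ultimately show ?thesis using 3 by simp
  next
    case 4
    then show ?thesis using never by (simp add: T_def)
  qed
qed

lemma X_pos_before_exit:
  assumes \<omega>: "\<omega> \<in> space M" and t: "0 \<le> t" "\<not> \<tau> \<omega> \<le> ereal t"
  shows "0 < X t \<omega>"
proof (rule ccontr)
  assume "\<not> 0 < X t \<omega>"
  moreover have "continuous_on {0..t} (\<lambda>s. X s \<omega>)"
    by (rule continuous_on_subset[OF X_continuous[OF \<omega>]]) auto
  ultimately obtain s where "0 \<le> s" "s \<le> t" "X s \<omega> = 0"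
    using IVT2'[of "\<lambda>s. X s \<omega>" t 0 0] t(1) x0 XY_start(1)[OF \<omega>] by auto
  then have "\<tau>1 \<omega> \<le> ereal t"
    unfolding T1_eq_hitting_time[OF x0 y0] hitting_time_le_iff[OF X_continuous[OF \<omega>]] by auto
  then show False using t(2) unfolding T_def by (simp add: min_le_iff_disj)
qed

text \<open>The function \<open>exp (a x + b y)\<close> of the process grows at rate \<open>kernel \<gamma> a b\<close>; it is harmonic exactly when the
  kernel vanishes, and then its value along the process is an exponential martingale.\<close>

lemma exp_process:
  "exp (X t \<omega> * a + Y t \<omega> * b)
    = exp (x0 * a + y0 * b) * exp (t * kernel \<gamma> a b) * stoch_exp (b - a) t \<omega>"
proof -
  have "X t \<omega> * a + Y t \<omega> * b
      = (x0 * a + y0 * b) + t * kernel \<gamma> a b + ((b - a) * W t \<omega> - (b - a)\<^sup>2 * t / 2)"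
    by (simp add: fst_Z snd_Z kernel_def power2_eq_square field_simps)
  then show ?thesis unfolding stoch_exp_def by (simp only: exp_add)
qed

definition exit_exp :: "real \<Rightarrow> real \<Rightarrow> 'a \<Rightarrow> real" where
  "exit_exp a b \<omega> = exp (X\<tau> \<tau> \<omega> * a + Y\<tau> \<tau> \<omega> * b) * indicator {\<omega>. \<tau> \<omega> < \<infinity>} \<omega>"

lemma exit_exp_eq:
  assumes "kernel \<gamma> a b = 0"
  shows "exit_exp a b \<omega> = exp (x0 * a + y0 * b)
    * (stoch_exp (b - a) (real_of_ereal (\<tau> \<omega>)) \<omega> * indicator {\<omega>. \<tau> \<omega> < \<infinity>} \<omega>)"
  unfolding exit_exp_def X_at_def Y_at_def exp_process assms by simp

lemma exit_exp_integrable: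
  assumes "kernel \<gamma> a b = 0"
  shows "integrable M (exit_exp a b)"
  unfolding exit_exp_eq[OF assms, abs_def] by (intro integrable_mult_right optional_stopping stopping_\<tau>)

lemma exit_exp_limit:
  assumes "kernel \<gamma> a b = 0"
  shows "(\<lambda>n. exp (x0 * a + y0 * b)
      * (\<integral>\<omega>. stoch_exp (b - a) (real n) \<omega> * indicator {\<omega> \<in> space M. \<tau> \<omega> \<le> ereal (real n)} \<omega> \<partial>M))
    \<longlonglongrightarrow> (\<integral>\<omega>. exit_exp a b \<omega> \<partial>M)"
  unfolding exit_exp_eq[OF assms] integral_mult_right_zero
  by (intro tendsto_mult_left optional_stopping stopping_\<tau>)

lemma integrable_until_exit:
  "0 \<le> t \<Longrightarrow> integrable M (\<lambda>\<omega>. stoch_exp \<theta> t \<omega> * indicator {\<omega> \<in> space M. \<tau> \<omega> \<le> ereal t} \<omega>)"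
  by (intro integrable_real_mult_indicator stopping_events stopping_\<tau> stoch_exp_expectation)

text \<open>The inequality between the value of a harmonic exponential at the exit and at the start, valid for both
  roots of the kernel; the asymptotic estimates rest on it.\<close>

lemma exit_exp_le:
  assumes "kernel \<gamma> a b = 0"
  shows "(\<integral>\<omega>. exit_exp a b \<omega> \<partial>M) \<le> exp (x0 * a + y0 * b)"
proof (rule LIMSEQ_le_const2[OF exit_exp_limit[OF assms]], intro exI allI impI)
  fix n :: nat
  have "(\<integral>\<omega>. stoch_exp (b - a) (real n) \<omega> * indicator {\<omega> \<in> space M. \<tau> \<omega> \<le> ereal (real n)} \<omega> \<partial>M)
      \<le> (\<integral>\<omega>. stoch_exp (b - a) (real n) \<omega> \<partial>M)"
    by (intro integral_mono integrable_until_exit stoch_exp_expectation) (auto simp: indicator_def)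
  then show "exp (x0 * a + y0 * b)
      * (\<integral>\<omega>. stoch_exp (b - a) (real n) \<omega> * indicator {\<omega> \<in> space M. \<tau> \<omega> \<le> ereal (real n)} \<omega> \<partial>M)
    \<le> exp (x0 * a + y0 * b)"
    by (simp add: stoch_exp_expectation)
qed

text \<open>At the smaller root no mass escapes: the tilted first coordinate has negative drift, so the tilted process
  leaves the quadrant almost surely. Quantitatively, as long as the process has not left the quadrant,
  \<open>X\<close> is positive, so \<open>exp (r X) \<ge> 1\<close>, and inserting this factor moves the first parameter to a point
  where the kernel is negative.\<close>

lemma exit_exp_eq_start:
  assumes b: "b < (1 - \<gamma>)\<^sup>2 / 2"
  shows "(\<integral>\<omega>. exit_exp (p_minus \<gamma> b) b \<omega> \<partial>M) = exp (x0 * p_minus \<gamma> b + y0 * b)"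
proof -
  define a where "a = p_minus \<gamma> b"
  define r where "r = sqrt ((1 - \<gamma>)\<^sup>2 - 2 * b)"
  have r: "0 < r" using b by (simp add: r_def)
  have K0: "kernel \<gamma> a b = 0" unfolding a_def using b by (intro kernel_p_minus) simp
  \<comment> \<open>The smaller root is where the kernel decreases, with slope \<open>-r\<close>; moving by \<open>r\<close> towards the
    larger root reaches the minimum.\<close>
  have Kr: "kernel \<gamma> (a + r) b = - r\<^sup>2 / 2"
  proof -
    have "kernel \<gamma> (a + r) b = kernel \<gamma> a b + r * (a - b + 1 - \<gamma>) + r\<^sup>2 / 2"
      by (simp add: kernel_def power2_eq_square field_simps)
    moreover have "a - b + 1 - \<gamma> = - r" by (simp add: a_def p_minus_def r_def)
    ultimately show ?thesis using K0 by (simp add: power2_eq_square)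
  qed
  define c where "c = exp (x0 * a + y0 * b)"
  define I where "I n = (\<integral>\<omega>. stoch_exp (b - a) (real n) \<omega>
    * indicator {\<omega> \<in> space M. \<tau> \<omega> \<le> ereal (real n)} \<omega> \<partial>M)" for n
  have bound: "c - c * I n \<le> exp (x0 * (a + r) + y0 * b) * exp (real n * (- r\<^sup>2 / 2))" for n
  proof -
    let ?A = "{\<omega> \<in> space M. \<tau> \<omega> \<le> ereal (real n)}"
    have "c - c * I n = c * (\<integral>\<omega>. stoch_exp (b - a) (real n) \<omega>
        - stoch_exp (b - a) (real n) \<omega> * indicator ?A \<omega> \<partial>M)"
      unfolding I_def by (subst Bochner_Integration.integral_diff)
        (auto intro!: integrable_until_exit stoch_exp_expectation simp: stoch_exp_expectation algebra_simps)
    also have "\<dots> = (\<integral>\<omega>. c * (stoch_exp (b - a) (real n) \<omega>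
        - stoch_exp (b - a) (real n) \<omega> * indicator ?A \<omega>) \<partial>M)" by simp
    also have "\<dots> \<le> (\<integral>\<omega>. exp (x0 * (a + r) + y0 * b) * exp (real n * (- r\<^sup>2 / 2))
        * stoch_exp (b - (a + r)) (real n) \<omega> \<partial>M)"
    proof (intro integral_mono integrable_mult_right Bochner_Integration.integrable_diff
        integrable_until_exit stoch_exp_expectation)
      fix \<omega> assume \<omega>: "\<omega> \<in> space M"
      show "c * (stoch_exp (b - a) (real n) \<omega> - stoch_exp (b - a) (real n) \<omega> * indicator ?A \<omega>)
        \<le> exp (x0 * (a + r) + y0 * b) * exp (real n * (- r\<^sup>2 / 2))
        * stoch_exp (b - (a + r)) (real n) \<omega>"
      proof (cases "\<omega> \<in> ?A")
        case False
        then have "0 < X (real n) \<omega>" using X_pos_before_exit[OF \<omega>, of "real n"] \<omega> by auto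
        then have "X (real n) \<omega> * a \<le> X (real n) \<omega> * (a + r)" using r by simp
        then have "exp (X (real n) \<omega> * a + Y (real n) \<omega> * b)
            \<le> exp (X (real n) \<omega> * (a + r) + Y (real n) \<omega> * b)" by simp
        then show ?thesis
          unfolding exp_process K0 Kr using False by (simp add: c_def)
      qed simp
    qed auto
    also have "\<dots> = exp (x0 * (a + r) + y0 * b) * exp (real n * (- r\<^sup>2 / 2))"
      by (simp add: stoch_exp_expectation)
    finally show ?thesis .
  qed
  have "(\<lambda>n. c - c * I n) \<longlonglongrightarrow> c - (\<integral>\<omega>. exit_exp a b \<omega> \<partial>M)"
    using exit_exp_limit[OF K0] unfolding c_def I_def by (intro tendsto_diff tendsto_const)
  moreover have "(\<lambda>n. exp (x0 * (a + r) + y0 * b) * exp (real n * (- r\<^sup>2 / 2))) \<longlonglongrightarrow> 0"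
    using r by real_asymp
  ultimately have "c - (\<integral>\<omega>. exit_exp a b \<omega> \<partial>M) \<le> 0"
    by (rule LIMSEQ_le) (use bound in auto)
  with exit_exp_le[OF K0] show ?thesis unfolding a_def c_def by simp
qed

text \<open>The boundary transforms as real expectations. For \<open>exit_left\<close> the integrand is integrable up to
  \<open>b = (1 - \<gamma>)\<^sup>2 / 2\<close>, hence also for some positive \<open>b\<close>, where \<open>L1\<close> is given by its continuation.\<close>

definition exit_left :: "real \<Rightarrow> real" where
  "exit_left b = (\<integral>\<omega>. exp (b * Y\<tau> \<tau>1 \<omega>) * indicator {\<omega>. \<tau>1 \<omega> < \<tau>2 \<omega>} \<omega> \<partial>M)"

definition exit_bottom :: "real \<Rightarrow> real" where
  "exit_bottom a = (\<integral>\<omega>. exp (a * X\<tau> \<tau>2 \<omega>) * indicator {\<omega>. \<tau>2 \<omega> < \<tau>1 \<omega>} \<omega> \<partial>M)"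

lemma left_event: "{\<omega> \<in> space M. \<tau>1 \<omega> < \<tau>2 \<omega>} \<in> events"
  and bottom_event: "{\<omega> \<in> space M. \<tau>2 \<omega> < \<tau>1 \<omega>} \<in> events"
proof -
  note [measurable] = stopping_random_variable[OF stopping_\<tau>1] stopping_random_variable[OF stopping_\<tau>2]
  show "{\<omega> \<in> space M. \<tau>1 \<omega> < \<tau>2 \<omega>} \<in> events" "{\<omega> \<in> space M. \<tau>2 \<omega> < \<tau>1 \<omega>} \<in> events"
    by measurable
qed

lemma
  assumes "kernel \<gamma> a b = 0"
  shows integrable_left: "integrable M (\<lambda>\<omega>. exp (b * Y\<tau> \<tau>1 \<omega>) * indicator {\<omega>. \<tau>1 \<omega> < \<tau>2 \<omega>} \<omega>)"
      (is "integrable M ?L")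
    and exit_exp_split: "(\<integral>\<omega>. exit_exp a b \<omega> \<partial>M) = exit_left b + exit_bottom a"
proof -
  let ?B = "\<lambda>\<omega>. exp (a * X\<tau> \<tau>2 \<omega>) * indicator {\<omega>. \<tau>2 \<omega> < \<tau>1 \<omega>} \<omega>"
  have eqL: "?L \<omega> = exit_exp a b \<omega> * indicator {\<omega> \<in> space M. \<tau>1 \<omega> < \<tau>2 \<omega>} \<omega>"
    and eqB: "?B \<omega> = exit_exp a b \<omega> * indicator {\<omega> \<in> space M. \<tau>2 \<omega> < \<tau>1 \<omega>} \<omega>"
    and eq: "exit_exp a b \<omega> = ?L \<omega> + ?B \<omega>" if "\<omega> \<in> space M" for \<omega>
    using that by (cases \<omega> rule: exit_cases; simp add: exit_exp_def mult.commute)+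
  note int = exit_exp_integrable[OF assms]
  have L: "integrable M ?L"
    by (subst Bochner_Integration.integrable_cong[OF refl eqL])
      (auto intro!: integrable_real_mult_indicator left_event int)
  have B: "integrable M ?B"
    by (subst Bochner_Integration.integrable_cong[OF refl eqB])
      (auto intro!: integrable_real_mult_indicator bottom_event int)
  show "integrable M ?L" by fact
  have "(\<integral>\<omega>. exit_exp a b \<omega> \<partial>M) = (\<integral>\<omega>. ?L \<omega> + ?B \<omega> \<partial>M)"
    by (rule Bochner_Integration.integral_cong[OF refl eq])
  then show "(\<integral>\<omega>. exit_exp a b \<omega> \<partial>M) = exit_left b + exit_bottom a"
    unfolding exit_left_def exit_bottom_def using L B by simp
qed

lemma exit_left_nonneg: "0 \<le> exit_left b"
  unfolding exit_left_def by (intro integral_nonneg_AE) auto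

lemma exit_bottom_nonneg: "0 \<le> exit_bottom b"
  unfolding exit_bottom_def by (intro integral_nonneg_AE) auto

text \<open>The bound uses the smaller root \<open>p_minus \<gamma> b\<close>: at the exit through the vertical axis the first
  coordinate vanishes, so the choice of root matters at the start only, and the smaller root gives the smaller bound.\<close>

lemma exit_left_le:
  assumes "b \<le> (1 - \<gamma>)\<^sup>2 / 2"
  shows "exit_left b \<le> exp (x0 * p_minus \<gamma> b + y0 * b)"
  using exit_exp_le[OF kernel_p_minus[OF assms]] exit_exp_split[OF kernel_p_minus[OF assms]]
    exit_bottom_nonneg[of "p_minus \<gamma> b"] by simp

text \<open>The relation by which \<open>L1\<close> is continued to nonnegative arguments, as an identity between expectations.\<close>

lemma functional_equation:
  assumes "b < (1 - \<gamma>)\<^sup>2 / 2"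
  shows "exit_left b + exit_bottom (p_minus \<gamma> b) = exp (x0 * p_minus \<gamma> b + y0 * b)"
  using exit_exp_eq_start[OF assms] exit_exp_split[OF kernel_p_minus[of b \<gamma>]] assms by simp

end

section \<open>The boundary transforms and their derivatives\<close>

text \<open>With \<open>c = - Re w\<close>, Taylor's formula bounds the remainder of the difference quotient for an increment \<open>z\<close>
  with \<open>|z| \<le> c / 2\<close> by \<open>|z| V\<^sup>2 exp (- c V / 2)\<close>, which is at most a constant multiple of \<open>|z|\<close>.\<close>

lemma (in finite_measure) laplace_has_field_derivative:
  fixes V :: "'a \<Rightarrow> real" and w :: complex
  assumes A: "A \<inter> space M \<in> sets M"
    and meas: "(\<lambda>x. V x * indicator A x) \<in> borel_measurable M"
    and nonneg: "\<And>x. x \<in> space M \<Longrightarrow> x \<in> A \<Longrightarrow> 0 \<le> V x"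
    and w: "Re w < 0"
  shows "((\<lambda>v. \<integral>x. exp (v * of_real (V x)) * indicator A x \<partial>M) has_field_derivative
    (\<integral>x. of_real (V x) * exp (w * of_real (V x)) * indicator A x \<partial>M)) (at w)"
proof -
  define c where "c = - Re w"
  have c: "0 < c" using w by (simp add: c_def)
  define \<Phi> where "\<Phi> v = (\<integral>x. exp (v * of_real (V x)) * indicator A x \<partial>M)" for v :: complex
  define D where "D = (\<integral>x. of_real (V x) * exp (w * of_real (V x)) * indicator A x \<partial>M)"
  have [measurable]: "(indicator A :: 'a \<Rightarrow> complex) \<in> borel_measurable M"
    using A by (simp add: borel_measurable_indicator_iff)
  have [measurable]: "(\<lambda>x. complex_of_real (V x * indicator A x)) \<in> borel_measurable M"
    using meas by measurable
  have meas_exp: "(\<lambda>x. exp (v * of_real (V x)) * indicator A x) \<in> borel_measurable M" for v :: complex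
  proof -
    have "(\<lambda>x. exp (v * of_real (V x * indicator A x)) * indicator A x) \<in> borel_measurable M"
      by measurable
    moreover have "exp (v * of_real (V x * indicator A x)) * indicator A x
        = exp (v * of_real (V x)) * indicator A x" for x
      by (simp add: indicator_def)
    ultimately show ?thesis by (simp only:)
  qed
  have meas_D: "(\<lambda>x. of_real (V x) * exp (w * of_real (V x)) * indicator A x) \<in> borel_measurable M"
  proof -
    have "(\<lambda>x. of_real (V x * indicator A x) * (exp (w * of_real (V x)) * indicator A x)) \<in> borel_measurable M"
      using meas_exp[of w] by measurable
    moreover have "of_real (V x * indicator A x) * (exp (w * of_real (V x)) * indicator A x)
        = of_real (V x) * exp (w * of_real (V x)) * indicator A x" for x
      by (simp add: indicator_def)
    ultimately show ?thesis by (simp only:)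
  qed
  have int_exp: "integrable M (\<lambda>x. exp (v * of_real (V x)) * indicator A x)" if "Re v \<le> 0" for v
    by (rule integrable_const_bound[where B = 1])
      (use that nonneg meas_exp in \<open>auto simp: indicator_def norm_mult mult_nonpos_nonneg\<close>)
  have int_D: "integrable M (\<lambda>x. of_real (V x) * exp (w * of_real (V x)) * indicator A x)"
  proof (rule integrable_const_bound[where B = "1 / c"])
    have "norm (of_real (V x) * exp (w * of_real (V x)) * indicator A x) \<le> 1 / c" if "x \<in> space M" for x
    proof (cases "x \<in> A")
      case True
      have "c * V x \<le> exp (c * V x)" using exp_ge_add_one_self[of "c * V x"] by linarith
      then have "V x * exp (- c * V x) \<le> 1 / c"
        using c by (simp add: exp_minus field_simps)
      then show ?thesis
        using True nonneg[OF that True] by (simp add: norm_mult c_def)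
    qed (use c in simp)
    then show "AE x in M. norm (of_real (V x) * exp (w * of_real (V x)) * indicator A x) \<le> 1 / c"
      by auto
  qed (rule meas_D)
  have remainder: "norm (exp ((w + z) * of_real (V x)) * indicator A x - exp (w * of_real (V x)) * indicator A x
      - z * (of_real (V x) * exp (w * of_real (V x)) * indicator A x)) \<le> (norm z)\<^sup>2 * (8 / c\<^sup>2)"
    if z: "norm z \<le> c / 2" and x: "x \<in> space M" for z x
  proof (cases "x \<in> A")
    case True
    let ?v = "V x"
    have v: "0 \<le> ?v" using nonneg x True by blast
    have "norm (exp ((w + z) * of_real ?v) - exp (w * of_real ?v) - z * (of_real ?v * exp (w * of_real ?v)))
        = norm (exp (w * of_real ?v) * (exp (z * of_real ?v) - (1 + z * of_real ?v)))"
      by (simp add: exp_add algebra_simps)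
    also have "\<dots> = exp (- c * ?v) * norm (exp (z * of_real ?v) - (1 + z * of_real ?v))"
      by (simp add: norm_mult c_def)
    also have "\<dots> \<le> exp (- c * ?v) * (exp \<bar>Re (z * of_real ?v)\<bar> * (norm (z * of_real ?v))\<^sup>2)"
      using Taylor_exp[of "z * of_real ?v" 1] by (intro mult_left_mono) (auto simp: power2_eq_square)
    also have "\<dots> \<le> exp (- c * ?v) * (exp (c / 2 * ?v) * (norm (z * of_real ?v))\<^sup>2)"
    proof -
      have "\<bar>Re (z * of_real ?v)\<bar> \<le> norm z * ?v"
        using abs_Re_le_cmod[of "z * of_real ?v"] v by (simp add: norm_mult)
      also have "\<dots> \<le> c / 2 * ?v" using z v by (intro mult_right_mono) auto
      finally show ?thesis by (intro mult_left_mono mult_right_mono) auto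
    qed
    also have "\<dots> = (norm z)\<^sup>2 * (?v\<^sup>2 * exp (- (c / 2 * ?v)))"
    proof -
      have "exp (- c * ?v) * exp (c / 2 * ?v) = exp (- (c / 2 * ?v))"
        by (simp flip: exp_add)
      then show ?thesis
        using v by (simp add: norm_mult power_mult_distrib mult_ac)
    qed
    also have "\<dots> \<le> (norm z)\<^sup>2 * (8 / c\<^sup>2)"
    proof (intro mult_left_mono)
      have "1 + c / 2 * ?v + (c / 2 * ?v)\<^sup>2 / 2 \<le> exp (c / 2 * ?v)"
        using v c by (intro exp_lower_Taylor_quadratic) auto
      moreover have "0 \<le> c / 2 * ?v" using v c by simp
      ultimately have "(c / 2 * ?v)\<^sup>2 / 2 \<le> exp (c / 2 * ?v)" by linarith
      then show "?v\<^sup>2 * exp (- (c / 2 * ?v)) \<le> 8 / c\<^sup>2"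
        using c by (simp add: exp_minus field_simps)
    qed simp
    finally show ?thesis using True by simp
  qed (use c in simp)
  define K where "K = 8 / c\<^sup>2 * measure M (space M)"
  have bound: "norm ((\<Phi> (w + z) - \<Phi> w) / z - D) \<le> K * norm z"
    if z: "norm z \<le> c / 2" "z \<noteq> 0" for z
  proof -
    have "Re (w + z) \<le> 0"
      using z(1) abs_Re_le_cmod[of z] c unfolding c_def by simp
    note ints = int_exp[OF this] int_exp[of w] int_D
    have "\<Phi> (w + z) - \<Phi> w - z * D
        = (\<integral>x. exp ((w + z) * of_real (V x)) * indicator A x - exp (w * of_real (V x)) * indicator A x
      - z * (of_real (V x) * exp (w * of_real (V x)) * indicator A x) \<partial>M)"
      unfolding \<Phi>_def D_def using ints w by simp
    also have "norm \<dots> \<le> (\<integral>x. (norm z)\<^sup>2 * (8 / c\<^sup>2) \<partial>M)"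
      by (intro order_trans[OF integral_norm_bound] integral_mono integrable_norm
          Bochner_Integration.integrable_diff integrable_mult_right remainder z(1))
        (use ints w in auto)
    also have "\<dots> = K * norm z * norm z"
      by (simp add: K_def power2_eq_square)
    finally have "norm (\<Phi> (w + z) - \<Phi> w - z * D) / norm z \<le> K * norm z"
      using z(2) by (simp add: field_simps)
    moreover have "(\<Phi> (w + z) - \<Phi> w) / z - D = (\<Phi> (w + z) - \<Phi> w - z * D) / z"
      using z(2) by (simp add: field_simps)
    ultimately show ?thesis by (simp add: norm_divide)
  qed
  have "((\<lambda>z. (\<Phi> (w + z) - \<Phi> w) / z - D) \<longlongrightarrow> 0) (at 0)"
  proof (rule Lim_null_comparison)
    show "\<forall>\<^sub>F z in at 0. norm ((\<Phi> (w + z) - \<Phi> w) / z - D) \<le> K * norm z"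
      unfolding eventually_at using c bound by (intro exI[of _ "c / 2"]) (auto simp: dist_norm)
    show "((\<lambda>z::complex. K * norm z) \<longlongrightarrow> 0) (at 0)"
      by (auto intro!: tendsto_eq_intros)
  qed
  then show ?thesis
    unfolding DERIV_def \<Phi>_def[symmetric] D_def[symmetric] by (rule LIM_zero_cancel)
qed

lemma Pminus_of_real:
  assumes "b \<le> (1 - \<gamma>)\<^sup>2 / 2"
  shows "Pminus \<gamma> (of_real b) = of_real (p_minus \<gamma> b)"
proof -
  have csqrt: "csqrt (of_real e) = of_real (sqrt e)" if "0 \<le> e" for e :: real
    using that by simp
  have "(1 - complex_of_real \<gamma>)\<^sup>2 - 2 * of_real b = of_real ((1 - \<gamma>)\<^sup>2 - 2 * b)" by simp
  moreover have "csqrt (of_real ((1 - \<gamma>)\<^sup>2 - 2 * b)) = of_real (sqrt ((1 - \<gamma>)\<^sup>2 - 2 * b))"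
    by (rule csqrt) (use assms in simp)
  ultimately show ?thesis by (simp add: Pminus_def p_minus_def)
qed

context quadrant_process
begin

lemma L1_transform_of_real: "L1_transform M W \<gamma> (x0, y0) (of_real b) = of_real (exit_left b)"
proof -
  have "exp (of_real b * of_real y) * indicator A \<omega> = complex_of_real (exp (b * y) * indicator A \<omega>)"
    for y A and \<omega> :: 'a
    by (simp add: indicator_def exp_of_real flip: of_real_mult)
  then show ?thesis
    unfolding L1_transform_def exit_left_def by (simp only: integral_complex_of_real)
qed

lemma L2_transform_of_real: "L2_transform M W \<gamma> (x0, y0) (of_real a) = of_real (exit_bottom a)"
proof -
  have "exp (of_real a * of_real y) * indicator A \<omega> = complex_of_real (exp (a * y) * indicator A \<omega>)"
    for y A and \<omega> :: 'a
    by (simp add: indicator_def exp_of_real flip: of_real_mult)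
  then show ?thesis
    unfolding L2_transform_def exit_bottom_def by (simp only: integral_complex_of_real)
qed

text \<open>The continued transform is still the expectation that defines it for negative arguments.\<close>

lemma L1_of_real:
  assumes "b < (1 - \<gamma>)\<^sup>2 / 2"
  shows "L1 M W \<gamma> (x0, y0) (of_real b) = of_real (exit_left b)"
proof (cases "b < 0")
  case True
  then show ?thesis by (simp add: L1_def L1_transform_of_real)
next
  case False
  have "exit_left b = exp (p_minus \<gamma> b * x0 + b * y0) - exit_bottom (p_minus \<gamma> b)"
    using functional_equation[OF assms] by (simp add: mult.commute)
  moreover have "Pminus \<gamma> (of_real b) = of_real (p_minus \<gamma> b)"
    using assms by (intro Pminus_of_real) simp
  ultimately show ?thesis
    using False unfolding L1_def
    by (simp add: L2_transform_of_real exp_of_real flip: of_real_mult of_real_add)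
qed

lemma left_position_measurable:
  "random_variable borel (\<lambda>\<omega>. Y\<tau> \<tau>1 \<omega> * indicator {\<omega>. \<tau>1 \<omega> < \<tau>2 \<omega>} \<omega>)"
proof -
  note [measurable] = stopping_random_variable[OF stopping_\<tau>1] stopping_random_variable[OF stopping_\<tau>2]
    stopped_W_random_variable[OF stopping_\<tau>1]
  have "Y\<tau> \<tau>1 \<omega> * indicator {\<omega>. \<tau>1 \<omega> < \<tau>2 \<omega>} \<omega>
      = (if \<tau>1 \<omega> < \<tau>2 \<omega> then y0 + W (real_of_ereal (\<tau>1 \<omega>)) \<omega> * indicator {\<omega>. \<tau>1 \<omega> < \<infinity>} \<omega>
          + real_of_ereal (\<tau>1 \<omega>) * \<gamma> else 0)" for \<omega>
    using less_le_trans[of "\<tau>1 \<omega>" "\<tau>2 \<omega>" \<infinity>] by (simp add: Y_at_def snd_Z)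
  then show ?thesis by (subst measurable_cong, assumption) measurable
qed

lemma left_position_nonneg: "\<omega> \<in> space M \<Longrightarrow> \<tau>1 \<omega> < \<tau>2 \<omega> \<Longrightarrow> 0 \<le> Y\<tau> \<tau>1 \<omega>"
  by (cases \<omega> rule: exit_cases) auto

definition exit_left_moment :: "real \<Rightarrow> real" where
  "exit_left_moment b
    = (\<integral>\<omega>. Y\<tau> \<tau>1 \<omega> * exp (b * Y\<tau> \<tau>1 \<omega>) * indicator {\<omega>. \<tau>1 \<omega> < \<tau>2 \<omega>} \<omega> \<partial>M)"

lemma deriv_L1:
  assumes "b < 0"
  shows "deriv (L1 M W \<gamma> (x0, y0)) (of_real b) = of_real (exit_left_moment b)"
proof (rule DERIV_imp_deriv, rule has_field_derivative_transform_within_open)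
  have eq: "of_real y * exp (of_real b * of_real y) * indicator A \<omega>
      = complex_of_real (y * exp (b * y) * indicator A \<omega>)" for y A and \<omega> :: 'a
    by (simp add: indicator_def exp_of_real flip: of_real_mult)
  have "{\<omega>. \<tau>1 \<omega> < \<tau>2 \<omega>} \<inter> space M \<in> events"
    using left_event by (simp add: Int_def conj_commute)
  then show "(L1_transform M W \<gamma> (x0, y0) has_field_derivative of_real (exit_left_moment b)) (at (of_real b))"
    using laplace_has_field_derivative[OF _ left_position_measurable, of "of_real b"] assms
      left_position_nonneg
    unfolding L1_transform_def[abs_def] exit_left_moment_def eq integral_complex_of_real by simp
  show "open {v. Re v < 0}" by (rule open_halfspace_Re_lt)
qed (use assms in \<open>auto simp: L1_def\<close>)

lemma exit_left_moment_nonneg: "0 \<le> exit_left_moment b"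
  unfolding exit_left_moment_def
  using left_position_nonneg by (intro integral_nonneg_AE AE_I2) (auto simp: indicator_def)

text \<open>The factor \<open>Y\<close> is absorbed by \<open>Y \<le> y0 * exp (Y / y0)\<close>. The choice of \<open>1 / y0\<close> as the exponential rate is what
  keeps the bound sharp: it costs only the constant factor \<open>exp 1\<close> at the start, uniformly in \<open>y0\<close>.\<close>

lemma exit_left_moment_le:
  assumes "b + 1 / y0 \<le> (1 - \<gamma>)\<^sup>2 / 2"
  shows "exit_left_moment b \<le> y0 * exp (x0 * p_minus \<gamma> (b + 1 / y0) + y0 * b + 1)"
proof -
  let ?ind = "\<lambda>\<omega>. indicator {\<omega>. \<tau>1 \<omega> < \<tau>2 \<omega>} \<omega> :: real"
  let ?f = "\<lambda>\<omega>. Y\<tau> \<tau>1 \<omega> * exp (b * Y\<tau> \<tau>1 \<omega>) * ?ind \<omega>"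
  let ?g = "\<lambda>\<omega>. y0 * (exp ((b + 1 / y0) * Y\<tau> \<tau>1 \<omega>) * ?ind \<omega>)"
  have int_g: "integrable M ?g"
    by (intro integrable_mult_right integrable_left[OF kernel_p_minus[OF assms]])
  have le: "?f \<omega> \<le> ?g \<omega>" for \<omega>
  proof -
    let ?y = "Y\<tau> \<tau>1 \<omega>"
    have "?y / y0 \<le> exp (?y / y0)" using exp_ge_add_one_self[of "?y / y0"] by linarith
    then have "?y \<le> y0 * exp (?y / y0)" using y0 by (simp add: field_simps)
    then have "?y * exp (b * ?y) \<le> y0 * exp (?y / y0) * exp (b * ?y)" by (intro mult_right_mono) auto
    also have "\<dots> = y0 * exp ((b + 1 / y0) * ?y)" by (simp add: distrib_right exp_add)
    finally show ?thesis by (auto simp: indicator_def)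
  qed
  have meas_f: "?f \<in> borel_measurable M"
  proof -
    have "(\<lambda>\<omega>. (Y\<tau> \<tau>1 \<omega> * ?ind \<omega>) * exp (b * (Y\<tau> \<tau>1 \<omega> * ?ind \<omega>))) \<in> borel_measurable M"
      using left_position_measurable by measurable
    moreover have "(Y\<tau> \<tau>1 \<omega> * ?ind \<omega>) * exp (b * (Y\<tau> \<tau>1 \<omega> * ?ind \<omega>)) = ?f \<omega>" for \<omega>
      by (simp add: indicator_def)
    ultimately show ?thesis by (simp only:)
  qed
  have int_f: "integrable M ?f"
  proof (rule Bochner_Integration.integrable_bound[OF int_g meas_f], rule AE_I2)
    fix \<omega> assume "\<omega> \<in> space M"
    then have "0 \<le> ?f \<omega>" using left_position_nonneg by (simp add: indicator_def)
    then show "norm (?f \<omega>) \<le> norm (?g \<omega>)"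
      unfolding real_norm_def using le[of \<omega>] by linarith
  qed
  have "exit_left_moment b \<le> (\<integral>\<omega>. ?g \<omega> \<partial>M)"
    unfolding exit_left_moment_def by (intro integral_mono int_f int_g le)
  also have "\<dots> = y0 * exit_left (b + 1 / y0)"
    by (simp add: exit_left_def)
  also have "\<dots> \<le> y0 * exp (x0 * p_minus \<gamma> (b + 1 / y0) + y0 * (b + 1 / y0))"
    using y0 by (intro mult_left_mono exit_left_le assms) auto
  also have "y0 * (b + 1 / y0) = y0 * b + 1" using y0 by (simp add: field_simps)
  finally show ?thesis by (simp add: add.assoc)
qed

end

section \<open>Exchanging the coordinates\<close>

lemma (in standard_brownian_motion) uminus_brownian_motion:
  "standard_brownian_motion M (\<lambda>t \<omega>. - W t \<omega>)"
proof unfold_locales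
  fix t :: real assume "0 \<le> t"
  then show "random_variable borel (\<lambda>\<omega>. - W t \<omega>)"
    using random_variable_W by measurable
next
  fix s t :: real assume st: "0 \<le> s" "s < t"
  have "distributed M lborel (\<lambda>\<omega>. 0 + (-1) * (W t \<omega> - W s \<omega>))
      (normal_density (0 + (-1) * 0) (\<bar>-1\<bar> * sqrt (t - s)))"
    using st by (intro normal_density_affine normal_increments) auto
  then show "distributed M lborel (\<lambda>\<omega>. - W t \<omega> - - W s \<omega>) (normal_density 0 (sqrt (t - s)))"
    by simp
next
  fix \<tau> :: "nat \<Rightarrow> real" and n :: nat assume "0 \<le> \<tau> 0" "mono \<tau>"
  then have "indep_vars (\<lambda>_. borel) (\<lambda>i \<omega>. - (W (\<tau> (Suc i)) \<omega> - W (\<tau> i) \<omega>)) {..<n}"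
    by (intro indep_vars_compose2[OF independent_increments]) auto
  then show "indep_vars (\<lambda>_. borel) (\<lambda>i \<omega>. - W (\<tau> (Suc i)) \<omega> - - W (\<tau> i) \<omega>) {..<n}"
    by simp
qed (auto simp: start_at_zero intro!: continuous_intros continuous_paths)

context quadrant_process
begin

text \<open>Exchanging the coordinates gives a process of the same kind, driven by \<open>- W\<close> and with \<open>1 - \<gamma>\<close> in place of
  \<open>\<gamma>\<close>. Statements about \<open>T2\<close> and \<open>L2\<close> are the statements about \<open>T1\<close> and \<open>L1\<close> for the exchanged process.\<close>

lemma swap: "quadrant_process M (\<lambda>t \<omega>. - W t \<omega>) (1 - \<gamma>) y0 x0"
  using uminus_brownian_motion \<gamma> x0 y0
  by (intro quadrant_process.intro quadrant_process_axioms.intro) auto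

lemma swap_T1: "T1 (\<lambda>t \<omega>. - W t \<omega>) (1 - \<gamma>) (y0, x0) = \<tau>2"
  and swap_T2: "T2 (\<lambda>t \<omega>. - W t \<omega>) (1 - \<gamma>) (y0, x0) = \<tau>1"
  using x0 y0
  by (auto simp: fun_eq_iff T1_eq_hitting_time T2_eq_hitting_time fst_Z snd_Z)

lemma swap_Y_at: "Y_at (\<lambda>t \<omega>. - W t \<omega>) (1 - \<gamma>) (y0, x0) S = X_at W \<gamma> (x0, y0) S"
  and swap_X_at: "X_at (\<lambda>t \<omega>. - W t \<omega>) (1 - \<gamma>) (y0, x0) S = Y_at W \<gamma> (x0, y0) S"
  by (simp_all add: X_at_def Y_at_def fun_eq_iff fst_Z snd_Z)

lemma swap_L1_transform:
  "L1_transform M (\<lambda>t \<omega>. - W t \<omega>) (1 - \<gamma>) (y0, x0) = L2_transform M W \<gamma> (x0, y0)"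
  by (simp add: fun_eq_iff L1_transform_def L2_transform_def swap_T1 swap_T2 swap_Y_at)

lemma swap_L2_transform:
  "L2_transform M (\<lambda>t \<omega>. - W t \<omega>) (1 - \<gamma>) (y0, x0) = L1_transform M W \<gamma> (x0, y0)"
  by (simp add: fun_eq_iff L1_transform_def L2_transform_def swap_T1 swap_T2 swap_X_at)

lemma swap_L1: "L1 M (\<lambda>t \<omega>. - W t \<omega>) (1 - \<gamma>) (y0, x0) = L2 M W \<gamma> (x0, y0)"
  by (simp add: fun_eq_iff L1_def L2_def swap_L1_transform swap_L2_transform Pminus_def Qminus_def add.commute)

lemma swap_exit_left: "quadrant_process.exit_left M (\<lambda>t \<omega>. - W t \<omega>) (1 - \<gamma>) y0 x0 = exit_bottom"
  by (simp add: fun_eq_iff quadrant_process.exit_left_def[OF swap] exit_bottom_def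
      swap_T1 swap_T2 swap_Y_at)

lemma swap_h: "h M (\<lambda>t \<omega>. - W t \<omega>) (1 - \<gamma>) 0 (y0, x0) = h M W \<gamma> (pi / 2) (x0, y0)"
  unfolding h_def swap_L1
  by (simp add: p_def q_def power2_eq_square field_simps)

lemma L2_of_real:
  assumes "a < \<gamma>\<^sup>2 / 2"
  shows "L2 M W \<gamma> (x0, y0) (of_real a) = of_real (exit_bottom a)"
  using quadrant_process.L1_of_real[OF swap, of a] assms by (simp add: swap_L1 swap_exit_left)

lemma exit_bottom_le:
  assumes "a \<le> \<gamma>\<^sup>2 / 2"
  shows "exit_bottom a \<le> exp (y0 * p_minus (1 - \<gamma>) a + x0 * a)"
  using quadrant_process.exit_left_le[OF swap, of a] assms by (simp add: swap_exit_left)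

end

section \<open>The harmonic functions on the parameter curve\<close>

text \<open>In terms of \<open>s = tan \<alpha> / (1 + tan \<alpha>)\<close> the curve of parameters is polynomial; \<open>1 - s\<close> and \<open>s\<close> are the drifts
  of the two coordinates under the transformed law.\<close>

lemma pq_parametrization:
  assumes "\<alpha> \<in> {0<..<pi/2}"
  obtains s where "0 < s" "s < 1"
    "p \<gamma> \<alpha> = (\<gamma>\<^sup>2 - s\<^sup>2) / 2" "q \<gamma> \<alpha> = ((1 - \<gamma>)\<^sup>2 - (1 - s)\<^sup>2) / 2"
proof -
  define u where "u = tan \<alpha>"
  have u: "0 < u" using assms by (simp add: u_def tan_gt_zero)
  show ?thesis
  proof (rule that[of "u / (1 + u)"])
    show "0 < u / (1 + u)" "u / (1 + u) < 1" using u by simp_all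
    have "1 / (2 * (1 + 1 / u)\<^sup>2) = (u / (1 + u))\<^sup>2 / 2"
      using u by (simp add: field_simps power2_eq_square)
    then show "p \<gamma> \<alpha> = (\<gamma>\<^sup>2 - (u / (1 + u))\<^sup>2) / 2"
      using assms unfolding p_def u_def[symmetric] by (simp add: diff_divide_distrib)
    have "1 - u / (1 + u) = 1 / (1 + u)" using u by (simp add: field_simps)
    then show "q \<gamma> \<alpha> = ((1 - \<gamma>)\<^sup>2 - (1 - u / (1 + u))\<^sup>2) / 2"
      using assms unfolding q_def u_def[symmetric] by (simp add: diff_divide_distrib power_one_over)
  qed
qed

lemma p_minus_parametrized:
  assumes "0 \<le> r"
  shows "p_minus \<gamma> (((1 - \<gamma>)\<^sup>2 - r\<^sup>2) / 2) = \<gamma> - 1 + ((1 - \<gamma>)\<^sup>2 - r\<^sup>2) / 2 - r"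
proof -
  have "(1 - \<gamma>)\<^sup>2 - 2 * (((1 - \<gamma>)\<^sup>2 - r\<^sup>2) / 2) = r\<^sup>2" by (simp add: field_simps)
  then show ?thesis using assms by (simp only: p_minus_def real_sqrt_abs abs_of_nonneg)
qed

context quadrant_process
begin

lemma kernel_pq:
  assumes "\<alpha> \<in> {0<..<pi/2}"
  shows "kernel \<gamma> (p \<gamma> \<alpha>) (q \<gamma> \<alpha>) = 0"
proof -
  obtain s where "p \<gamma> \<alpha> = (\<gamma>\<^sup>2 - s\<^sup>2) / 2" "q \<gamma> \<alpha> = ((1 - \<gamma>)\<^sup>2 - (1 - s)\<^sup>2) / 2"
    using pq_parametrization[OF assms] by blast
  then show ?thesis
    by (simp only: kernel_def) (simp add: power2_eq_square field_simps)
qed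

lemma h_eq_exit:
  assumes "\<alpha> \<in> {0<..<pi/2}"
  shows "h M W \<gamma> \<alpha> (x0, y0)
    = of_real (exp (x0 * p \<gamma> \<alpha> + y0 * q \<gamma> \<alpha>) - (\<integral>\<omega>. exit_exp (p \<gamma> \<alpha>) (q \<gamma> \<alpha>) \<omega> \<partial>M))"
proof -
  obtain s where s: "0 < s" "s < 1"
    "p \<gamma> \<alpha> = (\<gamma>\<^sup>2 - s\<^sup>2) / 2" "q \<gamma> \<alpha> = ((1 - \<gamma>)\<^sup>2 - (1 - s)\<^sup>2) / 2"
    using pq_parametrization[OF assms] by blast
  have "q \<gamma> \<alpha> < (1 - \<gamma>)\<^sup>2 / 2" "p \<gamma> \<alpha> < \<gamma>\<^sup>2 / 2"
    using s by (simp_all add: divide_strict_right_mono)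
  then show ?thesis
    using assms unfolding h_def exit_exp_split[OF kernel_pq[OF assms]]
    by (simp add: L1_of_real L2_of_real mult.commute)
qed

text \<open>The point \<open>(a, b)\<close> is the larger root in either variable; the smaller roots lie at \<open>a - 2 (1 - s)\<close> and
  \<open>b - 2 s\<close>. Using them on the two axes makes both contributions exponentially small relative to the
  harmonic function at the start.\<close>

lemma exit_exp_relative_bound:
  assumes "0 < s" "s < 1" "a = (\<gamma>\<^sup>2 - s\<^sup>2) / 2" "b = ((1 - \<gamma>)\<^sup>2 - (1 - s)\<^sup>2) / 2"
  shows "exit_left b + exit_bottom a
    \<le> exp (x0 * a + y0 * b) * (exp (- (2 * (1 - s) * x0)) + exp (- (2 * s * y0)))"
proof -
  have "p_minus \<gamma> b = \<gamma> - 1 + b - (1 - s)"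
    unfolding assms(4) by (rule p_minus_parametrized) (use assms(2) in simp)
  also have "\<dots> = a - 2 * (1 - s)"
    unfolding assms(3,4) by (simp add: power2_eq_square field_simps)
  finally have pb: "p_minus \<gamma> b = a - 2 * (1 - s)" .
  have a: "a = ((1 - (1 - \<gamma>))\<^sup>2 - s\<^sup>2) / 2" by (simp add: assms(3))
  have "p_minus (1 - \<gamma>) a = (1 - \<gamma>) - 1 + a - s"
    unfolding a by (rule p_minus_parametrized) (use assms(1) in simp)
  also have "\<dots> = b - 2 * s"
    unfolding assms(3,4) by (simp add: power2_eq_square field_simps)
  finally have pa: "p_minus (1 - \<gamma>) a = b - 2 * s" .
  have "exit_left b \<le> exp (x0 * p_minus \<gamma> b + y0 * b)"
    using assms by (intro exit_left_le) (simp add: divide_right_mono)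
  also have "\<dots> = exp (x0 * a + y0 * b) * exp (- (2 * (1 - s) * x0))"
    unfolding pb by (simp add: algebra_simps flip: exp_add)
  finally have left: "exit_left b \<le> exp (x0 * a + y0 * b) * exp (- (2 * (1 - s) * x0))" .
  have "exit_bottom a \<le> exp (y0 * p_minus (1 - \<gamma>) a + x0 * a)"
    using assms by (intro exit_bottom_le) (simp add: divide_right_mono)
  also have "\<dots> = exp (x0 * a + y0 * b) * exp (- (2 * s * y0))"
    unfolding pa by (simp add: algebra_simps flip: exp_add)
  finally show ?thesis using left by (simp add: distrib_left)
qed

text \<open>On the past of time \<open>n\<close> the density of the transformed law is the exponential martingale at \<open>n\<close>. By optional
  stopping, the probability of an exit before \<open>n\<close> therefore increases to the expectation of the harmonic
  function at the exit, divided by its value at the start.\<close>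

lemma doob_survival:
  assumes \<alpha>: "\<alpha> \<in> {0<..<pi/2}" and N: "doob_transform M W \<gamma> \<alpha> N"
  shows "exp (x0 * p \<gamma> \<alpha> + y0 * q \<gamma> \<alpha>) * measure N {\<omega> \<in> space N. \<tau> \<omega> = \<infinity>}
    = exp (x0 * p \<gamma> \<alpha> + y0 * q \<gamma> \<alpha>) - (\<integral>\<omega>. exit_exp (p \<gamma> \<alpha>) (q \<gamma> \<alpha>) \<omega> \<partial>M)"
proof -
  interpret N: prob_space N using N by (simp add: doob_transform_def)
  have spN: "space N = space M" and setsN: "sets N = sets (path_algebra M W {0..})"
    and dens: "\<And>t A. 0 \<le> t \<Longrightarrow> A \<in> sets (path_algebra M W {0..t}) \<Longrightarrow>
      emeasure N A = (\<integral>\<^sup>+\<omega>. ennreal (exp ((p \<gamma> \<alpha>, q \<gamma> \<alpha>) \<bullet> driftW W \<gamma> t \<omega>)) * indicator A \<omega> \<partial>M)"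
    using N by (auto simp: doob_transform_def)
  let ?\<theta> = "q \<gamma> \<alpha> - p \<gamma> \<alpha>"
  let ?c = "exp (x0 * p \<gamma> \<alpha> + y0 * q \<gamma> \<alpha>)"
  define E where "E n = {\<omega> \<in> space M. \<tau> \<omega> \<le> ereal (real n)}" for n :: nat
  have dens_eq: "exp ((p \<gamma> \<alpha>, q \<gamma> \<alpha>) \<bullet> driftW W \<gamma> t \<omega>) = stoch_exp ?\<theta> t \<omega>" for t \<omega>
  proof -
    have "(p \<gamma> \<alpha>, q \<gamma> \<alpha>) \<bullet> driftW W \<gamma> t \<omega>
        = t * kernel \<gamma> (p \<gamma> \<alpha>) (q \<gamma> \<alpha>) + (?\<theta> * W t \<omega> - ?\<theta>\<^sup>2 * t / 2)"
      by (simp add: driftW_def inner_prod_def kernel_def power2_eq_square field_simps)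
    then show ?thesis by (simp add: kernel_pq[OF \<alpha>] stoch_exp_def)
  qed
  have E_past: "E n \<in> sets (path_algebra M W {0..real n})" for n
    using stopping_\<tau> unfolding E_def stopping_def by auto
  then have E_N: "E n \<in> sets N" for n
    unfolding setsN using path_algebra_mono[of "{0..real n}" "{0..}"] by auto
  have E_measure: "measure N (E n) = (\<integral>\<omega>. stoch_exp ?\<theta> (real n) \<omega> * indicator (E n) \<omega> \<partial>M)" for n
  proof -
    have "emeasure N (E n) = (\<integral>\<^sup>+\<omega>. ennreal (stoch_exp ?\<theta> (real n) \<omega> * indicator (E n) \<omega>) \<partial>M)"
      unfolding dens[OF of_nat_0_le_iff E_past] dens_eq
      by (intro nn_integral_cong) (simp add: indicator_def)
    also have "\<dots> = ennreal (\<integral>\<omega>. stoch_exp ?\<theta> (real n) \<omega> * indicator (E n) \<omega> \<partial>M)"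
      unfolding E_def by (intro nn_integral_eq_integral integrable_until_exit) auto
    finally show ?thesis
      by (simp add: measure_def integral_nonneg_AE)
  qed
  have "incseq E"
    unfolding E_def by (intro incseq_SucI) (auto elim: order_trans)
  then have "(\<lambda>n. measure N (E n)) \<longlonglongrightarrow> measure N (\<Union>n. E n)"
    using E_N by (intro N.finite_Lim_measure_incseq) auto
  then have "(\<lambda>n. ?c * measure N (E n)) \<longlonglongrightarrow> ?c * measure N (\<Union>n. E n)"
    by (intro tendsto_mult_left)
  moreover have "(\<lambda>n. ?c * measure N (E n)) \<longlonglongrightarrow> (\<integral>\<omega>. exit_exp (p \<gamma> \<alpha>) (q \<gamma> \<alpha>) \<omega> \<partial>M)"
    using exit_exp_limit[OF kernel_pq[OF \<alpha>]] unfolding E_measure unfolding E_def .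
  ultimately have lim: "?c * measure N (\<Union>n. E n) = (\<integral>\<omega>. exit_exp (p \<gamma> \<alpha>) (q \<gamma> \<alpha>) \<omega> \<partial>M)"
    by (rule LIMSEQ_unique)
  have "{\<omega> \<in> space N. \<tau> \<omega> = \<infinity>} = space N - (\<Union>n. E n)"
  proof (intro set_eqI iffI)
    fix \<omega> assume \<omega>: "\<omega> \<in> space N - (\<Union>n. E n)"
    have "\<tau> \<omega> \<noteq> ereal t" for t
    proof
      assume "\<tau> \<omega> = ereal t"
      moreover obtain n where "t \<le> real n" using real_arch_simple by blast
      ultimately show False using \<omega> by (auto simp: E_def spN)
    qed
    moreover have "\<tau> \<omega> \<noteq> - \<infinity>"
      using stopping_\<tau> \<omega> by (auto simp: stopping_def spN)
    ultimately show "\<omega> \<in> {\<omega> \<in> space N. \<tau> \<omega> = \<infinity>}"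
      using \<omega> by (cases "\<tau> \<omega>") auto
  qed (auto simp: E_def)
  then have "measure N {\<omega> \<in> space N. \<tau> \<omega> = \<infinity>} = 1 - measure N (\<Union>n. E n)"
    using E_N by (simp add: N.prob_compl)
  then show ?thesis
    using lim by (simp add: right_diff_distrib)
qed

lemma h_0_eq: "h M W \<gamma> 0 (x0, y0)
    = of_real (y0 * exp (x0 * p \<gamma> 0 + y0 * q \<gamma> 0) - exit_left_moment (q \<gamma> 0))"
proof -
  have "q \<gamma> 0 = - \<gamma> * (1 - \<gamma> / 2)" by (simp add: q_def power2_eq_square field_simps)
  also have "\<dots> < 0" using \<gamma> by (simp add: mult_less_0_iff)
  finally show ?thesis by (simp add: h_def deriv_L1)
qed

text \<open>At \<open>\<alpha> = 0\<close> the discriminant \<open>(1 - \<gamma>)\<^sup>2 - 2 q\<close> equals one and \<open>p\<close> is the larger root, so the smaller root is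
  \<open>p - 2\<close>. Moving \<open>q\<close> by \<open>1 / y0 \<le> 1 / 2\<close> leaves the smaller root below \<open>p - 1 / 2\<close>.\<close>

lemma exit_left_moment_relative_bound:
  assumes "2 \<le> y0"
  shows "exit_left_moment (q \<gamma> 0) \<le> y0 * exp (x0 * p \<gamma> 0 + y0 * q \<gamma> 0) * exp (1 - x0 / 2)"
proof -
  let ?b = "q \<gamma> 0 + 1 / y0"
  have b: "(1 - \<gamma>)\<^sup>2 - 2 * ?b = 1 - 2 / y0"
    by (simp add: q_def power2_eq_square algebra_simps)
  have small: "1 / y0 \<le> 1 / 2" using assms by (simp add: field_simps)
  have "p_minus \<gamma> ?b \<le> \<gamma> - 1 + ?b"
    unfolding p_minus_def b using small by simp
  also have "\<dots> = p \<gamma> 0 - 1 + 1 / y0" by (simp add: p_def q_def)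
  also have "\<dots> \<le> p \<gamma> 0 - 1 / 2" using small by simp
  finally have "x0 * p_minus \<gamma> ?b \<le> x0 * (p \<gamma> 0 - 1 / 2)"
    using x0 by (intro mult_left_mono) auto
  then have "x0 * p_minus \<gamma> ?b + y0 * q \<gamma> 0 + 1 \<le> (x0 * p \<gamma> 0 + y0 * q \<gamma> 0) + (1 - x0 / 2)"
    by (simp add: algebra_simps)
  then have "exp (x0 * p_minus \<gamma> ?b + y0 * q \<gamma> 0 + 1)
      \<le> exp (x0 * p \<gamma> 0 + y0 * q \<gamma> 0) * exp (1 - x0 / 2)"
    unfolding exp_add[symmetric] by simp
  moreover have "exit_left_moment (q \<gamma> 0) \<le> y0 * exp (x0 * p_minus \<gamma> ?b + y0 * q \<gamma> 0 + 1)"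
    using b small by (intro exit_left_moment_le) (simp add: field_simps)
  ultimately show ?thesis
    using mult_left_mono[of _ _ y0] y0 by (fastforce simp: mult.assoc intro: order_trans)
qed

end

section \<open>Asymptotics\<close>

lemma asymp_equiv_relative_error:
  fixes H :: "real \<times> real \<Rightarrow> complex" and g e :: "real \<Rightarrow> real \<Rightarrow> real"
  assumes H: "\<And>x y. 2 \<le> x \<Longrightarrow> 2 \<le> y \<Longrightarrow>
      0 < g x y \<and> (\<exists>r. H (x, y) = of_real (g x y - r) \<and> \<bar>r\<bar> \<le> g x y * e x y)"
    and e: "((\<lambda>z. e (fst z) (snd z)) \<longlongrightarrow> 0) (at_top \<times>\<^sub>F at_top)"
  shows "H \<sim>[at_top \<times>\<^sub>F at_top] (\<lambda>(x, y). of_real (g x y))"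
proof (rule asymp_equivI')
  let ?F = "at_top \<times>\<^sub>F at_top :: (real \<times> real) filter"
  have "\<forall>\<^sub>F z in ?F. 2 \<le> fst z \<and> 2 \<le> snd z"
    unfolding eventually_prod_filter
    by (intro exI[of _ "\<lambda>x. 2 \<le> x"] conjI eventually_ge_at_top) auto
  then have "\<forall>\<^sub>F z in ?F. norm (H z / (case z of (x, y) \<Rightarrow> of_real (g x y)) - 1) \<le> e (fst z) (snd z)"
  proof eventually_elim
    case (elim z)
    obtain x y where z: "z = (x, y)" by (cases z)
    then obtain r where r: "H z = of_real (g x y - r)" "\<bar>r\<bar> \<le> g x y * e x y" and g: "0 < g x y"
      using H[of x y] elim by auto
    have "H z / of_real (g x y) - 1 = of_real (- r / g x y)"
      using g by (simp add: r(1) field_simps)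
    then have "norm (H z / of_real (g x y) - 1) = \<bar>r\<bar> / g x y"
      using g by (simp only: norm_of_real) simp
    also have "\<dots> \<le> e x y" using r(2) g by (simp add: field_simps)
    finally show ?case by (simp add: z)
  qed
  then have "((\<lambda>z. H z / (case z of (x, y) \<Rightarrow> of_real (g x y)) - 1) \<longlongrightarrow> 0) ?F"
    by (rule Lim_null_comparison[OF _ e])
  then show "((\<lambda>z. H z / (case z of (x, y) \<Rightarrow> of_real (g x y))) \<longlongrightarrow> 1) ?F"
    by (rule LIM_zero_cancel)
qed

theorem proposition9:
  fixes M :: "'a measure" and W :: "real \<Rightarrow> 'a \<Rightarrow> real" and \<gamma> :: real
  assumes "standard_brownian_motion M W" and "0 < \<gamma>" and "\<gamma> < 1"
  shows
    "(\<forall>x0>0. \<forall>y0>0.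
       (\<forall>\<alpha>\<in>{0<..<pi/2}.
          (\<forall>N. doob_transform M W \<gamma> \<alpha> N \<longrightarrow>
             h M W \<gamma> \<alpha> (x0, y0) =
               of_real (exp (x0 * p \<gamma> \<alpha> + y0 * q \<gamma> \<alpha>)
                 * measure N {\<omega> \<in> space N. T W \<gamma> (x0, y0) \<omega> = \<infinity>})) \<and>
          integrable M (\<lambda>\<omega>.
             exp (X_at W \<gamma> (x0, y0) (T W \<gamma> (x0, y0)) \<omega> * p \<gamma> \<alpha>
                  + Y_at W \<gamma> (x0, y0) (T W \<gamma> (x0, y0)) \<omega> * q \<gamma> \<alpha>)
             * indicator {\<omega>. T W \<gamma> (x0, y0) \<omega> < \<infinity>} \<omega>) \<and>
          h M W \<gamma> \<alpha> (x0, y0) =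
            of_real (exp (x0 * p \<gamma> \<alpha> + y0 * q \<gamma> \<alpha>)
              - (\<integral>\<omega>. exp (X_at W \<gamma> (x0, y0) (T W \<gamma> (x0, y0)) \<omega> * p \<gamma> \<alpha>
                         + Y_at W \<gamma> (x0, y0) (T W \<gamma> (x0, y0)) \<omega> * q \<gamma> \<alpha>)
                    * indicator {\<omega>. T W \<gamma> (x0, y0) \<omega> < \<infinity>} \<omega> \<partial>M))) \<and>
       h M W \<gamma> 0 (x0, y0) =
         of_real (y0 * exp (x0 * p \<gamma> 0 + y0 * q \<gamma> 0)
           - (\<integral>\<omega>. Y_at W \<gamma> (x0, y0) (T1 W \<gamma> (x0, y0)) \<omega>
                 * exp (q \<gamma> 0 * Y_at W \<gamma> (x0, y0) (T1 W \<gamma> (x0, y0)) \<omega>)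
                 * indicator {\<omega>. T1 W \<gamma> (x0, y0) \<omega> < T2 W \<gamma> (x0, y0) \<omega>} \<omega> \<partial>M)) \<and>
       h M W \<gamma> (pi/2) (x0, y0) =
         of_real (x0 * exp (x0 * p \<gamma> (pi/2) + y0 * q \<gamma> (pi/2))
           - (\<integral>\<omega>. X_at W \<gamma> (x0, y0) (T2 W \<gamma> (x0, y0)) \<omega>
                 * exp (p \<gamma> (pi/2) * X_at W \<gamma> (x0, y0) (T2 W \<gamma> (x0, y0)) \<omega>)
                 * indicator {\<omega>. T2 W \<gamma> (x0, y0) \<omega> < T1 W \<gamma> (x0, y0) \<omega>} \<omega> \<partial>M))) \<and>
     (\<forall>\<alpha>\<in>{0<..<pi/2}.
        h M W \<gamma> \<alpha> \<sim>[at_top \<times>\<^sub>F at_top]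
          (\<lambda>(x0, y0). of_real (exp (x0 * p \<gamma> \<alpha> + y0 * q \<gamma> \<alpha>)))) \<and>
     h M W \<gamma> 0 \<sim>[at_top \<times>\<^sub>F at_top]
       (\<lambda>(x0, y0). of_real (y0 * exp (x0 * p \<gamma> 0 + y0 * q \<gamma> 0))) \<and>
     h M W \<gamma> (pi/2) \<sim>[at_top \<times>\<^sub>F at_top]
       (\<lambda>(x0, y0). of_real (x0 * exp (x0 * p \<gamma> (pi/2) + y0 * q \<gamma> (pi/2))))"
proof -
  interpret standard_brownian_motion M W by fact
  have qp: "quadrant_process M W \<gamma> x y" if "0 < x" "0 < y" for x y
    using that assms by (intro quadrant_process.intro quadrant_process_axioms.intro)
  have interior: "(\<forall>N. doob_transform M W \<gamma> \<alpha> N \<longrightarrow>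
             h M W \<gamma> \<alpha> (x0, y0) =
               of_real (exp (x0 * p \<gamma> \<alpha> + y0 * q \<gamma> \<alpha>)
                 * measure N {\<omega> \<in> space N. T W \<gamma> (x0, y0) \<omega> = \<infinity>})) \<and>
          integrable M (\<lambda>\<omega>.
             exp (X_at W \<gamma> (x0, y0) (T W \<gamma> (x0, y0)) \<omega> * p \<gamma> \<alpha>
                  + Y_at W \<gamma> (x0, y0) (T W \<gamma> (x0, y0)) \<omega> * q \<gamma> \<alpha>)
             * indicator {\<omega>. T W \<gamma> (x0, y0) \<omega> < \<infinity>} \<omega>) \<and>
          h M W \<gamma> \<alpha> (x0, y0) =
            of_real (exp (x0 * p \<gamma> \<alpha> + y0 * q \<gamma> \<alpha>)
              - (\<integral>\<omega>. exp (X_at W \<gamma> (x0, y0) (T W \<gamma> (x0, y0)) \<omega> * p \<gamma> \<alpha>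
                         + Y_at W \<gamma> (x0, y0) (T W \<gamma> (x0, y0)) \<omega> * q \<gamma> \<alpha>)
                    * indicator {\<omega>. T W \<gamma> (x0, y0) \<omega> < \<infinity>} \<omega> \<partial>M))"
    if "0 < x0" "0 < y0" "\<alpha> \<in> {0<..<pi/2}" for x0 y0 \<alpha>
  proof -
    interpret quadrant_process M W \<gamma> x0 y0 using that by (intro qp)
    show ?thesis
      unfolding exit_exp_def[symmetric, abs_def]
      using h_eq_exit[OF that(3)] doob_survival[OF that(3)] exit_exp_integrable[OF kernel_pq[OF that(3)]]
      by simp
  qed
  have at_0: "h M W \<gamma> 0 (x0, y0) =
         of_real (y0 * exp (x0 * p \<gamma> 0 + y0 * q \<gamma> 0)
           - (\<integral>\<omega>. Y_at W \<gamma> (x0, y0) (T1 W \<gamma> (x0, y0)) \<omega>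
                 * exp (q \<gamma> 0 * Y_at W \<gamma> (x0, y0) (T1 W \<gamma> (x0, y0)) \<omega>)
                 * indicator {\<omega>. T1 W \<gamma> (x0, y0) \<omega> < T2 W \<gamma> (x0, y0) \<omega>} \<omega> \<partial>M))"
    if "0 < x0" "0 < y0" for x0 y0
  proof -
    interpret quadrant_process M W \<gamma> x0 y0 using that by (intro qp)
    show ?thesis using h_0_eq unfolding exit_left_moment_def .
  qed
  have pq_swap: "p (1 - \<gamma>) 0 = q \<gamma> (pi / 2)" "q (1 - \<gamma>) 0 = p \<gamma> (pi / 2)"
    by (simp_all add: p_def q_def power2_eq_square field_simps)
  have at_pi_half: "h M W \<gamma> (pi/2) (x0, y0) =
         of_real (x0 * exp (x0 * p \<gamma> (pi/2) + y0 * q \<gamma> (pi/2))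
           - (\<integral>\<omega>. X_at W \<gamma> (x0, y0) (T2 W \<gamma> (x0, y0)) \<omega>
                 * exp (p \<gamma> (pi/2) * X_at W \<gamma> (x0, y0) (T2 W \<gamma> (x0, y0)) \<omega>)
                 * indicator {\<omega>. T2 W \<gamma> (x0, y0) \<omega> < T1 W \<gamma> (x0, y0) \<omega>} \<omega> \<partial>M))"
    if "0 < x0" "0 < y0" for x0 y0
  proof -
    interpret quadrant_process M W \<gamma> x0 y0 using that by (intro qp)
    show ?thesis
      using quadrant_process.h_0_eq[OF swap]
      unfolding quadrant_process.exit_left_moment_def[OF swap] swap_h swap_T1 swap_T2 swap_Y_at pq_swap
      by (simp add: add.commute)
  qed
  have fst_lim: "filterlim fst at_top (at_top \<times>\<^sub>F at_top :: (real \<times> real) filter)"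
    and snd_lim: "filterlim snd at_top (at_top \<times>\<^sub>F at_top :: (real \<times> real) filter)"
    by (rule filterlim_fst filterlim_snd)+
  have decay: "((\<lambda>z. exp (c - d * f z)) \<longlongrightarrow> 0) (at_top \<times>\<^sub>F at_top)"
    if "0 < d" "filterlim f at_top (at_top \<times>\<^sub>F at_top)" for c d :: real and f :: "real \<times> real \<Rightarrow> real"
  proof -
    have "((\<lambda>x. exp (c - d * x)) \<longlongrightarrow> 0) at_top" using \<open>0 < d\<close> by real_asymp
    then show ?thesis by (rule filterlim_compose) fact
  qed
  have asymp_interior: "h M W \<gamma> \<alpha> \<sim>[at_top \<times>\<^sub>F at_top]
      (\<lambda>(x0, y0). of_real (exp (x0 * p \<gamma> \<alpha> + y0 * q \<gamma> \<alpha>)))" if \<alpha>: "\<alpha> \<in> {0<..<pi/2}" for \<alpha>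
  proof -
    obtain s where s: "0 < s" "s < 1"
      "p \<gamma> \<alpha> = (\<gamma>\<^sup>2 - s\<^sup>2) / 2" "q \<gamma> \<alpha> = ((1 - \<gamma>)\<^sup>2 - (1 - s)\<^sup>2) / 2"
      using pq_parametrization[OF \<alpha>] by blast
    show ?thesis
    proof (rule asymp_equiv_relative_error[where e = "\<lambda>x y. exp (0 - 2 * (1 - s) * x) + exp (0 - 2 * s * y)"])
      fix x y :: real assume "2 \<le> x" "2 \<le> y"
      then interpret quadrant_process M W \<gamma> x y by (intro qp) auto
      have "\<bar>\<integral>\<omega>. exit_exp (p \<gamma> \<alpha>) (q \<gamma> \<alpha>) \<omega> \<partial>M\<bar>
          \<le> exp (x * p \<gamma> \<alpha> + y * q \<gamma> \<alpha>) * (exp (0 - 2 * (1 - s) * x) + exp (0 - 2 * s * y))"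
        using exit_exp_relative_bound[OF s] exit_exp_split[OF kernel_pq[OF \<alpha>]]
          exit_left_nonneg[of "q \<gamma> \<alpha>"] exit_bottom_nonneg[of "p \<gamma> \<alpha>"]
        by (simp only: diff_0 abs_of_nonneg add_nonneg_nonneg)
      then show "0 < exp (x * p \<gamma> \<alpha> + y * q \<gamma> \<alpha>) \<and> (\<exists>r. h M W \<gamma> \<alpha> (x, y)
          = of_real (exp (x * p \<gamma> \<alpha> + y * q \<gamma> \<alpha>) - r) \<and> \<bar>r\<bar>
          \<le> exp (x * p \<gamma> \<alpha> + y * q \<gamma> \<alpha>) * (exp (0 - 2 * (1 - s) * x) + exp (0 - 2 * s * y)))"
        using h_eq_exit[OF \<alpha>] by (intro conjI exI exp_gt_zero)
    next
      show "((\<lambda>z. exp (0 - 2 * (1 - s) * fst z) + exp (0 - 2 * s * snd z)) \<longlongrightarrow> 0) (at_top \<times>\<^sub>F at_top)"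
        using s by (intro tendsto_add_zero decay fst_lim snd_lim) auto
    qed
  qed
  have asymp_0: "h M W \<gamma> 0 \<sim>[at_top \<times>\<^sub>F at_top]
      (\<lambda>(x0, y0). of_real (y0 * exp (x0 * p \<gamma> 0 + y0 * q \<gamma> 0)))"
  proof (rule asymp_equiv_relative_error[where e = "\<lambda>x y. exp (1 - 1 / 2 * x)"])
    fix x y :: real assume xy: "2 \<le> x" "2 \<le> y"
    then interpret quadrant_process M W \<gamma> x y by (intro qp) auto
    show "0 < y * exp (x * p \<gamma> 0 + y * q \<gamma> 0) \<and> (\<exists>r. h M W \<gamma> 0 (x, y)
        = of_real (y * exp (x * p \<gamma> 0 + y * q \<gamma> 0) - r)
        \<and> \<bar>r\<bar> \<le> y * exp (x * p \<gamma> 0 + y * q \<gamma> 0) * exp (1 - 1 / 2 * x))"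
      using xy h_0_eq exit_left_moment_relative_bound exit_left_moment_nonneg[of "q \<gamma> 0"]
      by (intro conjI exI[of _ "exit_left_moment (q \<gamma> 0)"]) auto
  qed (intro decay fst_lim, simp)
  have asymp_pi_half: "h M W \<gamma> (pi/2) \<sim>[at_top \<times>\<^sub>F at_top]
      (\<lambda>(x0, y0). of_real (x0 * exp (x0 * p \<gamma> (pi/2) + y0 * q \<gamma> (pi/2))))"
  proof (rule asymp_equiv_relative_error[where e = "\<lambda>x y. exp (1 - 1 / 2 * y)"])
    fix x y :: real assume xy: "2 \<le> x" "2 \<le> y"
    then interpret quadrant_process M W \<gamma> x y by (intro qp) auto
    interpret swap: quadrant_process M "\<lambda>t \<omega>. - W t \<omega>" "1 - \<gamma>" y x by (rule swap)
    let ?r = "swap.exit_left_moment (q (1 - \<gamma>) 0)"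
    have "h M W \<gamma> (pi / 2) (x, y) = of_real (x * exp (x * p \<gamma> (pi / 2) + y * q \<gamma> (pi / 2)) - ?r)"
      using swap.h_0_eq by (simp only: swap_h pq_swap add.commute)
    moreover have "\<bar>?r\<bar> \<le> x * exp (x * p \<gamma> (pi / 2) + y * q \<gamma> (pi / 2)) * exp (1 - 1 / 2 * y)"
      using swap.exit_left_moment_relative_bound[OF xy(1)] swap.exit_left_moment_nonneg[of "q (1 - \<gamma>) 0"]
      by (simp add: pq_swap add.commute)
    ultimately show "0 < x * exp (x * p \<gamma> (pi/2) + y * q \<gamma> (pi/2)) \<and> (\<exists>r. h M W \<gamma> (pi/2) (x, y)
        = of_real (x * exp (x * p \<gamma> (pi/2) + y * q \<gamma> (pi/2)) - r)
        \<and> \<bar>r\<bar> \<le> x * exp (x * p \<gamma> (pi/2) + y * q \<gamma> (pi/2)) * exp (1 - 1 / 2 * y))"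
      using xy by (intro conjI exI[of _ ?r]) auto
  qed (intro decay snd_lim, simp)
  show ?thesis
    using interior at_0 at_pi_half asymp_interior asymp_0 asymp_pi_half by simp
qed

end
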